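(* Let $a,b>0$, $\Omega=(-a,a)\times(-b,b)\subset\mathbb{R}^2$, and let $F:\overline{\Omega}\times\mathbb{R}^{2}\to\mathbb{R}$ be jointly continuous. Let $X_{\mathcal{T}_0}^{\sharp}$ be the completion of the uniform convergence space $X_{\mathcal{T}_0}$ associated with the Cauchy problem $$D_yu(x,y)+F(x,y,u(x,y),D_xu(x,y))=0,\ (x,y)\in\Omega,\qquad u(x,0)=f(x),\ x\in(-a,a),$$ and let $\widehat{\mathcal{T}}_0^{\sharp}:X_{\mathcal{T}_0}^{\sharp}\to Y=\mathcal{ML}^0_0(\Omega)\times\mathcal{C}^1[-a,a]$ be the unique uniformly continuous extension of $\widehat{\mathcal{T}}_0:X_{\mathcal{T}_0}\to Y$ (all as defined in the context). Then for every $f\in\mathcal{C}^1[-a,a]$ there exists a unique $U^{\sharp}\in X_{\mathcal{T}_0}^{\sharp}$ such that $$\widehat{\mathcal{T}}_0^{\sharp}U^{\sharp}=(0,f).$$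
   Context: Convergence structures, uniform convergence structures (u.c.s.), Cauchy filters and completions are in the sense of Beattie and Butzmann, *Convergence Structures and Applications to Functional Analysis*. A filter $\mathcal{F}$ on a set and a map $g$ give the image filter $g(\mathcal{F})$ generated by the sets $g(F)$, $F\in\mathcal{F}$. **Baire operators.** Let $\overline{\mathbb{R}}=\mathbb{R}\cup\{\pm\infty\}$. For $u:\Omega\to\overline{\mathbb{R}}$ put $I(u)(x)=\sup_{\delta>0}\inf\{u(y):y\in B_\delta(x)\}$ and $S(u)(x)=\inf_{\delta>0}\sup\{u(y):y\in B_\delta(x)\}$, with $y$ ranging over $\Omega$. If $u$ is defined only on a dense subset $D$ of $\Omega$, $y$ ranges over $B_\delta(x)\cap D$, so $S(u)$ is defined on all of $\Omega$ and $(I\circ S)(u)=I(S(u))$. A function $u:\Omega\to\overline{\mathbb{R}}$ is normal lower semi-continuous if $I(S(u))(x)=u(x)$ for all $x\in\Omega$. **Function spaces.** For an integer $m\ge 0$, $\mathcal{ML}^m_0(\Omega)$ is the set of normal lower semi-continuous $u:\Omega\to\overline{\mathbb{R}}$ for which there is a closed nowhere dense set $\Gamma_u\subset\Omega$ of Lebesgue measure zero with $u\in\mathcal{C}^m(\Omega\setminus\Gamma_u)$ (in particular $u$ is real-valued on $\Omega\setminus\Gamma_u$). Put $$X=\mathcal{ML}^1_{0,0}(\Omega)=\{u\in\mathcal{ML}^1_0(\Omega): u(\cdot,0)\in\mathcal{C}^1[-a,a]\},$$ where $u(\cdot,0)\in\mathcal{C}^1[-a,a]$ means that $x\mapsto u(x,0)$,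 $x\in(-a,a)$, is the restriction of a (necessarily unique) function in $\mathcal{C}^1[-a,a]$; this function is denoted $\mathcal{R}_0u$. Put $Y=\mathcal{ML}^0_0(\Omega)\times\mathcal{C}^1[-a,a]$. **Operators.** For $u\in\mathcal{ML}^1_0(\Omega)$, $\mathcal{T}u=(I\circ S)(g_u)\in\mathcal{ML}^0_0(\Omega)$, where $g_u(x,y)=D_yu(x,y)+F(x,y,u(x,y),D_xu(x,y))$ for $(x,y)\in\Omega\setminus\Gamma_u$. Define $\mathcal{T}_0:X\to Y$, $\mathcal{T}_0u=(\mathcal{T}u,\mathcal{R}_0u)$. Define $u\sim_{\mathcal{T}_0}v\iff\mathcal{T}_0u=\mathcal{T}_0v$ on $X$, let $X_{\mathcal{T}_0}=X/\!\sim_{\mathcal{T}_0}$, and let $\widehat{\mathcal{T}}_0:X_{\mathcal{T}_0}\to Y$ be the induced injective map. **Uniform convergence structures.** - On $\mathcal{ML}^0_0(\Omega)$: a filter $\mathcal{F}$ belongs to $\lambda_a(u)$ iff there is $E\subset\Omega$ of Lebesgue measure zero such that, for every $x\in\Omega\setminus E$, the filter $\mathcal{F}(x)$ generated by $\{\{v(x):v\in A\}:A\in\mathcal{F}\}$ converges to $u(x)$. A filter $\mathcal{U}$ on $\mathcal{ML}^0_0(\Omega)\times\mathcal{ML}^0_0(\Omega)$ belongs to $\mathcal{J}_a$ iff there are $k\in\mathbb{N}$, $u_1,\dots,u_k\in\mathcal{ML}^0_0(\Omega)$ and filters $\mathcal{F}_i\in\lambda_a(u_i)$ with $(\mathcal{F}_1\times\mathcal{F}_1)\cap\dots\cap(\mathcal{F}_k\times\mathcal{F}_k)\subseteq\mathcal{U}$.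 - On $\mathcal{C}^1[-a,a]$: $\mathcal{F}\in\lambda_0(f)$ iff $[f]\subseteq\mathcal{F}$, where $[f]=\{A\subseteq\mathcal{C}^1[-a,a]:f\in A\}$. $\mathcal{J}_0$ is defined from $\lambda_0$ exactly as $\mathcal{J}_a$ is defined from $\lambda_a$. - On $Y$: $\mathcal{V}\in\mathcal{J}_Y$ iff $(\pi_0\times\pi_0)(\mathcal{V})\in\mathcal{J}_a$ and $(\pi_1\times\pi_1)(\mathcal{V})\in\mathcal{J}_0$, where $\pi_0,\pi_1$ are the projections of $Y$ onto $\mathcal{ML}^0_0(\Omega)$ and $\mathcal{C}^1[-a,a]$. $(Y,\mathcal{J}_Y)$ is Hausdorff and complete. - On $X_{\mathcal{T}_0}$: a filter $\mathcal{U}$ on $X_{\mathcal{T}_0}\times X_{\mathcal{T}_0}$ belongs to $\mathcal{J}_{\mathcal{T}_0}$ iff $(\widehat{\mathcal{T}}_0\times\widehat{\mathcal{T}}_0)(\mathcal{U})\in\mathcal{J}_Y$. **Completion.** For a Hausdorff uniform convergence space $(Z,\mathcal{J})$, a filter $\mathcal{F}$ on $Z$ is Cauchy if $\mathcal{F}\times\mathcal{F}\in\mathcal{J}$; on the set $\mathbf{C}(Z)$ of Cauchy filters put $\mathcal{F}\sim_c\mathcal{G}$ iff some $\mathcal{H}\in\mathbf{C}(Z)$ satisfies $\mathcal{H}\subseteq\mathcal{F}\cap\mathcal{G}$. The underlying set of the completion is $Z^{\sharp}=\mathbf{C}(Z)/\!\sim_c$, with $Z$ embedded by sending $z$ to the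 class of the filters converging to $z$. $X_{\mathcal{T}_0}^{\sharp}$ is the completion of $(X_{\mathcal{T}_0},\mathcal{J}_{\mathcal{T}_0})$. The extension $\widehat{\mathcal{T}}_0^{\sharp}$ sends the class of a Cauchy filter $\mathcal{F}$ to the limit in $Y$ of the filter $\widehat{\mathcal{T}}_0(\mathcal{F})$. *)

theory Defs
  imports "HOL-Analysis.Analysis"
begin

text \<open>
  Functions on a set \<open>\<Omega>\<close> are represented by total functions that are \<open>undefined\<close> off \<open>\<Omega>\<close>
  (\<^const>\<open>extensional\<close>), so that HOL equality is equality of functions on \<open>\<Omega>\<close>.
\<close>


section \<open>Uniform convergence structures and completion\<close>

text \<open>
  The library orders filters by reverse inclusion of their families of sets: a textbook inclusion
  \<open>\<F> \<subseteq> \<G>\<close> reads \<open>\<G> \<le> \<F>\<close>, the intersection of filters is \<^const>\<open>sup\<close>, and \<open>[x]\<close> is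
  \<open>principal {x}\<close>. Library filters may be improper and live on whole types; a (proper) filter on
  a set \<open>Z\<close> is a filter other than \<^const>\<open>bot\<close> that contains \<open>Z\<close>.
\<close>

definition filters_on :: "'a set \<Rightarrow> 'a filter set" where
  "filters_on Z = {\<F>. \<F> \<noteq> bot \<and> \<F> \<le> principal Z}"

definition ucs_of_convergence ::
  "'a set \<Rightarrow> ('a \<Rightarrow> 'a filter set) \<Rightarrow> ('a \<times> 'a) filter set" where
  "ucs_of_convergence Z \<Lambda> =
     {\<U> \<in> filters_on (Z \<times> Z).
        \<exists>k\<ge>1::nat. \<exists>u \<F>. (\<forall>i\<in>{1..k}. u i \<in> Z \<and> \<F> i \<in> \<Lambda> (u i)) \<and>
          \<U> \<le> (SUP i\<in>{1..k}. \<F> i \<times>\<^sub>F \<F> i)}"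

definition ucs_converges :: "('a \<times> 'a) filter set \<Rightarrow> 'a filter \<Rightarrow> 'a \<Rightarrow> bool" where
  "ucs_converges J \<F> z \<longleftrightarrow> \<F> \<times>\<^sub>F principal {z} \<in> J"

definition ucs_lim :: "'a set \<Rightarrow> ('a \<times> 'a) filter set \<Rightarrow> 'a filter \<Rightarrow> 'a" where
  "ucs_lim Z J \<F> = (THE z. z \<in> Z \<and> ucs_converges J \<F> z)"

definition cauchy_filters :: "'a set \<Rightarrow> ('a \<times> 'a) filter set \<Rightarrow> 'a filter set" where
  "cauchy_filters Z J = {\<F> \<in> filters_on Z. \<F> \<times>\<^sub>F \<F> \<in> J}"

definition cauchy_equiv ::
  "'a set \<Rightarrow> ('a \<times> 'a) filter set \<Rightarrow> ('a filter \<times> 'a filter) set" where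
  "cauchy_equiv Z J =
     {(\<F>, \<G>). \<F> \<in> cauchy_filters Z J \<and> \<G> \<in> cauchy_filters Z J \<and>
        (\<exists>\<H>\<in>cauchy_filters Z J. sup \<F> \<G> \<le> \<H>)}"

definition ucs_completion :: "'a set \<Rightarrow> ('a \<times> 'a) filter set \<Rightarrow> 'a filter set set" where
  "ucs_completion Z J = cauchy_filters Z J // cauchy_equiv Z J"

text \<open>
  The extension to the completion of a uniformly continuous map \<open>g\<close> into the complete Hausdorff
  space \<open>(W, K)\<close>; \<^const>\<open>the_elem\<close> picks the common value on all representatives of a class.
\<close>

definition completion_extension ::
  "'b set \<Rightarrow> ('b \<times> 'b) filter set \<Rightarrow> ('a \<Rightarrow> 'b) \<Rightarrow> 'a filter set \<Rightarrow> 'b" where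
  "completion_extension W K g C = the_elem ((\<lambda>\<F>. ucs_lim W K (filtermap g \<F>)) ` C)"


section \<open>Baire operators\<close>

text \<open>\<open>D\<close> is the domain of \<open>u\<close>, a dense subset of \<open>\<Omega>\<close>; for \<open>u\<close> defined on all of \<open>\<Omega>\<close> take \<open>D = \<Omega>\<close>.\<close>

definition baire_I ::
  "'a::metric_space set \<Rightarrow> 'a set \<Rightarrow> ('a \<Rightarrow> ereal) \<Rightarrow> 'a \<Rightarrow> ereal" where
  "baire_I \<Omega> D u = (\<lambda>x\<in>\<Omega>. SUP \<delta>\<in>{0<..}. INF y\<in>ball x \<delta> \<inter> D. u y)"

definition baire_S ::
  "'a::metric_space set \<Rightarrow> 'a set \<Rightarrow> ('a \<Rightarrow> ereal) \<Rightarrow> 'a \<Rightarrow> ereal" where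
  "baire_S \<Omega> D u = (\<lambda>x\<in>\<Omega>. INF \<delta>\<in>{0<..}. SUP y\<in>ball x \<delta> \<inter> D. u y)"

definition normal_lsc :: "'a::metric_space set \<Rightarrow> ('a \<Rightarrow> ereal) \<Rightarrow> bool" where
  "normal_lsc \<Omega> u \<longleftrightarrow> (\<forall>x\<in>\<Omega>. baire_I \<Omega> \<Omega> (baire_S \<Omega> \<Omega> u) x = u x)"


section \<open>Function spaces\<close>

definition partial_x :: "(real \<times> real \<Rightarrow> real) \<Rightarrow> real \<times> real \<Rightarrow> real" where
  "partial_x f = (\<lambda>(x, y). deriv (\<lambda>s. f (s, y)) x)"

definition partial_y :: "(real \<times> real \<Rightarrow> real) \<Rightarrow> real \<times> real \<Rightarrow> real" where
  "partial_y f = (\<lambda>(x, y). deriv (\<lambda>t. f (x, t)) y)"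

text \<open>\<open>C\<^sup>m(W)\<close> for open \<open>W\<close>: all iterated partial derivatives up to order \<open>m\<close> exist and are continuous.\<close>

primrec Cm_on :: "nat \<Rightarrow> (real \<times> real) set \<Rightarrow> (real \<times> real \<Rightarrow> real) \<Rightarrow> bool" where
  "Cm_on 0 W f \<longleftrightarrow> continuous_on W f"
| "Cm_on (Suc m) W f \<longleftrightarrow>
     continuous_on W f \<and>
     (\<forall>(x, y)\<in>W. (\<lambda>s. f (s, y)) field_differentiable at x \<and>
                  (\<lambda>t. f (x, t)) field_differentiable at y) \<and>
     Cm_on m W (partial_x f) \<and> Cm_on m W (partial_y f)"

definition Omega :: "real \<Rightarrow> real \<Rightarrow> (real \<times> real) set" where
  "Omega a b = {-a<..<a} \<times> {-b<..<b}"

text \<open>The sets admissible as \<open>\<Gamma>\<^sub>u\<close>; they are closed relative to \<open>\<Omega>\<close>.\<close>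

definition singular_set ::
  "nat \<Rightarrow> (real \<times> real) set \<Rightarrow> (real \<times> real \<Rightarrow> ereal) \<Rightarrow> (real \<times> real) set \<Rightarrow> bool" where
  "singular_set m \<Omega> u \<Gamma> \<longleftrightarrow>
     \<Gamma> \<subseteq> \<Omega> \<and> closedin (top_of_set \<Omega>) \<Gamma> \<and> interior (closure \<Gamma>) = {} \<and>
     \<Gamma> \<in> null_sets lebesgue \<and>
     (\<forall>z\<in>\<Omega> - \<Gamma>. \<bar>u z\<bar> \<noteq> \<infinity>) \<and> Cm_on m (\<Omega> - \<Gamma>) (\<lambda>z. real_of_ereal (u z))"

definition ML0 :: "nat \<Rightarrow> (real \<times> real) set \<Rightarrow> (real \<times> real \<Rightarrow> ereal) set" where
  "ML0 m \<Omega> = {u \<in> extensional \<Omega>. normal_lsc \<Omega> u \<and> (\<exists>\<Gamma>. singular_set m \<Omega> u \<Gamma>)}"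

text \<open>\<open>C\<^sup>1[-a,a]\<close>, with one-sided derivatives at the end points.\<close>

definition C1_interval :: "real \<Rightarrow> (real \<Rightarrow> real) set" where
  "C1_interval a =
     {f \<in> extensional {-a..a}.
        \<exists>f'. (\<forall>x\<in>{-a..a}. (f has_real_derivative f' x) (at x within {-a..a})) \<and>
             continuous_on {-a..a} f'}"

definition extends_trace :: "real \<Rightarrow> (real \<times> real \<Rightarrow> ereal) \<Rightarrow> (real \<Rightarrow> real) \<Rightarrow> bool" where
  "extends_trace a u g \<longleftrightarrow> g \<in> C1_interval a \<and> (\<forall>x\<in>{-a<..<a}. u (x, 0) = ereal (g x))"

definition R0 :: "real \<Rightarrow> (real \<times> real \<Rightarrow> ereal) \<Rightarrow> real \<Rightarrow> real" where
  "R0 a u = (THE g. extends_trace a u g)"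

definition X_space :: "real \<Rightarrow> real \<Rightarrow> (real \<times> real \<Rightarrow> ereal) set" where
  "X_space a b = {u \<in> ML0 1 (Omega a b). \<exists>g. extends_trace a u g}"

definition Y_space :: "real \<Rightarrow> real \<Rightarrow> ((real \<times> real \<Rightarrow> ereal) \<times> (real \<Rightarrow> real)) set" where
  "Y_space a b = ML0 0 (Omega a b) \<times> C1_interval a"


section \<open>The operators of the Cauchy problem\<close>

text \<open>
  The arguments \<open>(x, y, u, p)\<close> of the nonlinearity are grouped as \<open>((x, y), (u, p))\<close>. The function
  \<open>g\<^sub>u\<close> is meaningful on \<open>\<Omega> - \<Gamma>\<^sub>u\<close> only; \<open>\<Gamma>\<^sub>u\<close> is an arbitrary admissible set, and \<open>T_op\<close> does
  not depend on its choice since \<open>g\<^sub>u\<close> is continuous off \<open>\<Gamma>\<^sub>u\<close>.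
\<close>

definition pde_expr ::
  "((real \<times> real) \<times> (real \<times> real) \<Rightarrow> real) \<Rightarrow> (real \<times> real \<Rightarrow> ereal) \<Rightarrow> real \<times> real \<Rightarrow> real" where
  "pde_expr F u z =
     (let v = (\<lambda>w. real_of_ereal (u w)) in partial_y v z + F (z, (v z, partial_x v z)))"

definition T_op ::
  "real \<Rightarrow> real \<Rightarrow> ((real \<times> real) \<times> (real \<times> real) \<Rightarrow> real) \<Rightarrow>
     (real \<times> real \<Rightarrow> ereal) \<Rightarrow> (real \<times> real \<Rightarrow> ereal)" where
  "T_op a b F u =
     (let \<Omega> = Omega a b; \<Gamma> = (SOME \<Gamma>. singular_set 1 \<Omega> u \<Gamma>)
      in baire_I \<Omega> \<Omega> (baire_S \<Omega> (\<Omega> - \<Gamma>) (\<lambda>z. ereal (pde_expr F u z))))"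

definition T0 ::
  "real \<Rightarrow> real \<Rightarrow> ((real \<times> real) \<times> (real \<times> real) \<Rightarrow> real) \<Rightarrow>
     (real \<times> real \<Rightarrow> ereal) \<Rightarrow> (real \<times> real \<Rightarrow> ereal) \<times> (real \<Rightarrow> real)" where
  "T0 a b F u = (T_op a b F u, R0 a u)"

definition X_T0 ::
  "real \<Rightarrow> real \<Rightarrow> ((real \<times> real) \<times> (real \<times> real) \<Rightarrow> real) \<Rightarrow> (real \<times> real \<Rightarrow> ereal) set set" where
  "X_T0 a b F =
     X_space a b // {(u, v). u \<in> X_space a b \<and> v \<in> X_space a b \<and> T0 a b F u = T0 a b F v}"

definition T0_hat ::
  "real \<Rightarrow> real \<Rightarrow> ((real \<times> real) \<times> (real \<times> real) \<Rightarrow> real) \<Rightarrow>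
     (real \<times> real \<Rightarrow> ereal) set \<Rightarrow> (real \<times> real \<Rightarrow> ereal) \<times> (real \<Rightarrow> real)" where
  "T0_hat a b F C = the_elem (T0 a b F ` C)"


section \<open>The uniform convergence structures and the completion\<close>

definition conv_a ::
  "(real \<times> real) set \<Rightarrow> (real \<times> real \<Rightarrow> ereal) \<Rightarrow> (real \<times> real \<Rightarrow> ereal) filter set" where
  "conv_a \<Omega> u =
     {\<F> \<in> filters_on (ML0 0 \<Omega>).
        \<exists>E. E \<subseteq> \<Omega> \<and> E \<in> null_sets lebesgue \<and> (\<forall>z\<in>\<Omega> - E. ((\<lambda>v. v z) \<longlongrightarrow> u z) \<F>)}"

definition ucs_a ::
  "(real \<times> real) set \<Rightarrow> ((real \<times> real \<Rightarrow> ereal) \<times> (real \<times> real \<Rightarrow> ereal)) filter set" where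
  "ucs_a \<Omega> = ucs_of_convergence (ML0 0 \<Omega>) (conv_a \<Omega>)"

definition conv_0 :: "real \<Rightarrow> (real \<Rightarrow> real) \<Rightarrow> (real \<Rightarrow> real) filter set" where
  "conv_0 a f = {\<F> \<in> filters_on (C1_interval a). \<F> \<le> principal {f}}"

definition ucs_0 :: "real \<Rightarrow> ((real \<Rightarrow> real) \<times> (real \<Rightarrow> real)) filter set" where
  "ucs_0 a = ucs_of_convergence (C1_interval a) (conv_0 a)"

definition ucs_Y ::
  "real \<Rightarrow> real \<Rightarrow>
     (((real \<times> real \<Rightarrow> ereal) \<times> (real \<Rightarrow> real)) \<times>
      ((real \<times> real \<Rightarrow> ereal) \<times> (real \<Rightarrow> real))) filter set" where
  "ucs_Y a b =
     {\<V> \<in> filters_on (Y_space a b \<times> Y_space a b).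
        filtermap (map_prod fst fst) \<V> \<in> ucs_a (Omega a b) \<and>
        filtermap (map_prod snd snd) \<V> \<in> ucs_0 a}"

definition ucs_T0 ::
  "real \<Rightarrow> real \<Rightarrow> ((real \<times> real) \<times> (real \<times> real) \<Rightarrow> real) \<Rightarrow>
     ((real \<times> real \<Rightarrow> ereal) set \<times> (real \<times> real \<Rightarrow> ereal) set) filter set" where
  "ucs_T0 a b F =
     {\<U> \<in> filters_on (X_T0 a b F \<times> X_T0 a b F).
        filtermap (map_prod (T0_hat a b F) (T0_hat a b F)) \<U> \<in> ucs_Y a b}"

definition X_T0_sharp ::
  "real \<Rightarrow> real \<Rightarrow> ((real \<times> real) \<times> (real \<times> real) \<Rightarrow> real) \<Rightarrow>
     (real \<times> real \<Rightarrow> ereal) set filter set set" where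
  "X_T0_sharp a b F = ucs_completion (X_T0 a b F) (ucs_T0 a b F)"

definition T0_hat_sharp ::
  "real \<Rightarrow> real \<Rightarrow> ((real \<times> real) \<times> (real \<times> real) \<Rightarrow> real) \<Rightarrow>
     (real \<times> real \<Rightarrow> ereal) set filter set \<Rightarrow> (real \<times> real \<Rightarrow> ereal) \<times> (real \<Rightarrow> real)" where
  "T0_hat_sharp a b F = completion_extension (Y_space a b) (ucs_Y a b) (T0_hat a b F)"

end

(*
  The completion is a set of limits in disguise. In the convergence structures at hand two filters
  F, G have F x G in the uniform structure exactly if they have a common limit, so Y is complete,
  and the classes of Cauchy filters on X_T0 correspond to the limits in Y of their images: the
  extended operator is injective, which gives uniqueness. For existence it remains to find a
  sequence u_n in X with trace f and T u_n -> 0 almost everywhere. As convergence is only pointwise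
  off a null set, a neighbourhood of y = 0 that shrinks to y = 0 may be neglected: there u_n = f(x),
  and elsewhere u_n is affine in y on the cells of a grid of mesh 1/n.
*)

theory Submission
  imports Defs
begin

section \<open>Complete Hausdorff uniform convergence structures\<close>

text \<open>The two components of Y ask for opposite kinds of accuracy. In \<open>conv_0\<close>
  nothing but the principal filter at f converges to f, so the trace cannot be approximated: every
  u_n must equal f on y = 0. In \<open>conv_a\<close> the equation need only hold in the limit, at
  almost every fixed point and at no uniform rate, so jumps across grid lines cost nothing and the
  strip need not be matched to the cells beyond it. In such a cell the affine function starts at 0
  on the lower edge; its slope in y tends to -F(z,0,0) while the cell shrinks, so its value tends to
  0, and its x-derivative is 0. Each u_n has its own exceptional set, but a sequence has only
  countably many, so one null set serves all n, as \<open>conv_a\<close> demands. In the abstract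
  half the finiteness of k in the generated uniform structure is decisive: finitely many distinct
  limits can be separated simultaneously by disjoint sets.\<close>

lemma filters_on_Times_iff:
  "F \<times>\<^sub>F G \<in> filters_on (A \<times> B) \<longleftrightarrow> F \<in> filters_on A \<and> G \<in> filters_on B"
  by (auto simp: filters_on_def prod_filter_eq_bot prod_filter_mono_iff
        simp flip: principal_prod_principal)

lemma filtermap_map_prod_prod_filter:
  "filtermap (map_prod f g) (F \<times>\<^sub>F G) = filtermap f F \<times>\<^sub>F filtermap g G"
  by (simp add: prod_filtermap1 prod_filtermap2 filtermap_filtermap apfst_def apsnd_def
      map_prod_def case_prod_beta')

text \<open>Two filters with improper infimum have incompatible members; as there are finitely many
  filters, the separators of each one can be conjoined.\<close>

lemma finite_disjoint_filters:
  assumes "finite V" "\<And>v w. v \<in> V \<Longrightarrow> w \<in> V \<Longrightarrow> v \<noteq> w \<Longrightarrow> inf (H v) (H w) = bot"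
  obtains P where "\<And>v. v \<in> V \<Longrightarrow> eventually (P v) (H v)"
    "\<And>v w x. v \<in> V \<Longrightarrow> w \<in> V \<Longrightarrow> P v x \<Longrightarrow> P w x \<Longrightarrow> v = w"
proof -
  have "\<forall>v\<in>V. \<forall>w\<in>V. \<exists>A B. v \<noteq> w \<longrightarrow>
      eventually A (H v) \<and> eventually B (H w) \<and> (\<forall>x. \<not> (A x \<and> B x))"
  proof (intro ballI)
    fix v w assume vw: "v \<in> V" "w \<in> V"
    show "\<exists>A B. v \<noteq> w \<longrightarrow>
      eventually A (H v) \<and> eventually B (H w) \<and> (\<forall>x. \<not> (A x \<and> B x))"
    proof (cases "v = w")
      case False
      with assms(2)[OF vw] have "eventually (\<lambda>_. False) (inf (H v) (H w))" by simp
      then show ?thesis unfolding eventually_inf by blast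
    qed auto
  qed
  then obtain A B where AB: "\<And>v w. v \<in> V \<Longrightarrow> w \<in> V \<Longrightarrow> v \<noteq> w \<Longrightarrow>
      eventually (A v w) (H v) \<and> eventually (B v w) (H w) \<and> (\<forall>x. \<not> (A v w x \<and> B v w x))"
    unfolding bchoice_iff by metis
  \<comment> \<open>The separators are chosen for ordered pairs, so \<open>v\<close> collects its
    role as first and as second member: for \<open>v \<noteq> w\<close>, \<open>P v\<close> supplies
    \<open>A v w\<close> and \<open>P w\<close> supplies the incompatible
    \<open>B v w\<close>.\<close>
  define P where "P v x \<longleftrightarrow> (\<forall>w\<in>V - {v}. A v w x \<and> B w v x)" for v x
  show thesis
  proof
    show "eventually (P v) (H v)" if "v \<in> V" for v
      unfolding P_def using that AB assms(1)
      by (intro eventually_ball_finite) (auto intro: eventually_conj)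
    show "v = w" if "v \<in> V" "w \<in> V" "P v x" "P w x" for v w x
    proof (rule ccontr)
      assume "v \<noteq> w"
      with that have "A v w x" "B v w x" by (auto simp: P_def)
      with AB that \<open>v \<noteq> w\<close> show False by blast
    qed
  qed
qed

text \<open>Cauchy filters, limits and the completion depend on \<open>J\<close> only through the products
  \<open>F \<times> G\<close> that it contains, so the axioms constrain nothing else.\<close>

locale complete_hausdorff_ucs =
  fixes Z :: "'a set" and J :: "('a \<times> 'a) filter set" and \<Lambda> :: "'a \<Rightarrow> 'a filter set"
  assumes sup_in: "F \<in> \<Lambda> z \<Longrightarrow> G \<in> \<Lambda> z \<Longrightarrow> sup F G \<in> \<Lambda> z"
    and down: "F \<in> \<Lambda> z \<Longrightarrow> G \<le> F \<Longrightarrow> G \<noteq> bot \<Longrightarrow> G \<in> \<Lambda> z"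
    and point_in: "z \<in> Z \<Longrightarrow> principal {z} \<in> \<Lambda> z"
    and unique: "z \<in> Z \<Longrightarrow> w \<in> Z \<Longrightarrow> F \<in> \<Lambda> z \<Longrightarrow> F \<in> \<Lambda> w \<Longrightarrow> z = w"
    and prod_in_iff: "F \<times>\<^sub>F G \<in> J \<longleftrightarrow> (\<exists>z\<in>Z. F \<in> \<Lambda> z \<and> G \<in> \<Lambda> z)"
begin

text \<open>By \<open>prod_in_iff\<close>, convergence to \<open>w\<close> gives \<open>F\<close>
  and the point filter at \<open>w\<close> a common limit, and that point filter has no limit in
  \<open>Z\<close> but \<open>w\<close>. So the limits defined through \<open>J\<close> are those of
  \<open>\<Lambda>\<close>.\<close>

lemma ucs_lim_eq:
  assumes "z \<in> Z" "F \<in> \<Lambda> z"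
  shows "ucs_lim Z J F = z"
proof -
  have "(w \<in> Z \<and> ucs_converges J F w) \<longleftrightarrow> w = z" for w
    unfolding ucs_converges_def prod_in_iff using assms point_in unique by metis
  then show ?thesis by (simp add: ucs_lim_def)
qed

section \<open>Initial uniform structures and their completion\<close>

context
  fixes A :: "'b set" and g :: "'b \<Rightarrow> 'a" and K :: "('b \<times> 'b) filter set"
  assumes K_eq: "K = {\<U> \<in> filters_on (A \<times> A). filtermap (map_prod g g) \<U> \<in> J}"
begin

lemma cauchy_filters_initial_iff:
  "F \<in> cauchy_filters A K \<longleftrightarrow> F \<in> filters_on A \<and> (\<exists>z\<in>Z. filtermap g F \<in> \<Lambda> z)"
  by (auto simp: cauchy_filters_def K_eq filters_on_Times_iff filtermap_map_prod_prod_filter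
      prod_in_iff)

text \<open>One direction takes \<open>sup F G\<close> itself, whose image still converges to the
  common limit. In the other, a limit passes to every finer proper filter, so a common coarser
  Cauchy filter forces its limit on both.\<close>

lemma cauchy_equiv_initial_iff:
  "(F, G) \<in> cauchy_equiv A K \<longleftrightarrow> F \<in> cauchy_filters A K \<and> G \<in> cauchy_filters A K \<and>
     ucs_lim Z J (filtermap g F) = ucs_lim Z J (filtermap g G)"
proof -
  have "(\<exists>H\<in>cauchy_filters A K. sup F G \<le> H) \<longleftrightarrow>
      ucs_lim Z J (filtermap g F) = ucs_lim Z J (filtermap g G)"
    if F: "F \<in> cauchy_filters A K" and G: "G \<in> cauchy_filters A K"
  proof
    assume "ucs_lim Z J (filtermap g F) = ucs_lim Z J (filtermap g G)"
    then obtain z where z: "z \<in> Z" "filtermap g F \<in> \<Lambda> z" "filtermap g G \<in> \<Lambda> z"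
      using F G unfolding cauchy_filters_initial_iff by (metis ucs_lim_eq)
    have "sup F G \<in> filters_on A"
      using F G by (auto simp: cauchy_filters_def filters_on_def)
    moreover have "filtermap g (sup F G) \<in> \<Lambda> z"
      using z by (simp add: filtermap_sup sup_in)
    ultimately show "\<exists>H\<in>cauchy_filters A K. sup F G \<le> H"
      using z(1) by (intro bexI[of _ "sup F G"]) (auto simp: cauchy_filters_initial_iff)
  next
    assume "\<exists>H\<in>cauchy_filters A K. sup F G \<le> H"
    then obtain H where H: "H \<in> cauchy_filters A K" "F \<le> H" "G \<le> H" by auto
    have lim: "ucs_lim Z J (filtermap g F') = ucs_lim Z J (filtermap g H)"
      if F': "F' \<in> cauchy_filters A K" "F' \<le> H" for F'
    proof -
      from H obtain w where w: "w \<in> Z" "filtermap g H \<in> \<Lambda> w"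
        unfolding cauchy_filters_initial_iff by blast
      have "filtermap g F' \<in> \<Lambda> w"
        using w(2) filtermap_mono[OF F'(2)]
      proof (rule down)
        show "filtermap g F' \<noteq> bot"
          using F'(1) by (auto simp: cauchy_filters_def filters_on_def filtermap_bot_iff)
      qed
      with w show ?thesis by (simp add: ucs_lim_eq)
    qed
    show "ucs_lim Z J (filtermap g F) = ucs_lim Z J (filtermap g G)"
      using lim[OF F] lim[OF G] H by simp
  qed
  then show ?thesis unfolding cauchy_equiv_def by blast
qed

lemma equiv_cauchy_equiv_initial: "equiv (cauchy_filters A K) (cauchy_equiv A K)"
  by (auto intro!: equivI refl_onI symI transI simp: cauchy_equiv_initial_iff)

text \<open>The limit of the image is constant on an equivalence class, which is what makes
  \<open>the_elem\<close> meaningful.\<close>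

lemma completion_extension_initial:
  assumes "F \<in> cauchy_filters A K"
  shows "completion_extension Z J g (cauchy_equiv A K `` {F}) = ucs_lim Z J (filtermap g F)"
proof -
  have "(\<lambda>G. ucs_lim Z J (filtermap g G)) ` (cauchy_equiv A K `` {F}) =
      {ucs_lim Z J (filtermap g F)}"
    using assms by (auto simp: cauchy_equiv_initial_iff)
  then show ?thesis by (simp add: completion_extension_def)
qed

lemma inj_on_completion_extension_initial:
  "inj_on (completion_extension Z J g) (ucs_completion A K)"
proof (rule inj_onI)
  fix C D
  assume "C \<in> ucs_completion A K" "D \<in> ucs_completion A K"
    and eq: "completion_extension Z J g C = completion_extension Z J g D"
  then obtain F G where F: "F \<in> cauchy_filters A K" "C = cauchy_equiv A K `` {F}"
    and G: "G \<in> cauchy_filters A K" "D = cauchy_equiv A K `` {G}"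
    unfolding ucs_completion_def by (auto elim!: quotientE)
  with eq have "(F, G) \<in> cauchy_equiv A K"
    by (simp add: cauchy_equiv_initial_iff completion_extension_initial)
  then show "C = D"
    using F G equiv_class_eq[OF equiv_cauchy_equiv_initial] by simp
qed

text \<open>A filter with convergent image is already Cauchy for the initial structure, so its own
  class does the job.\<close>

lemma completion_extension_initial_attains:
  assumes "z \<in> Z" "F \<in> filters_on A" "filtermap g F \<in> \<Lambda> z"
  shows "\<exists>C\<in>ucs_completion A K. completion_extension Z J g C = z"
proof
  have F: "F \<in> cauchy_filters A K"
    using assms unfolding cauchy_filters_initial_iff by blast
  then show "cauchy_equiv A K `` {F} \<in> ucs_completion A K"
    by (simp add: ucs_completion_def quotientI)
  show "completion_extension Z J g (cauchy_equiv A K `` {F}) = z"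
    using F assms by (simp add: completion_extension_initial ucs_lim_eq)
qed

end

end

section \<open>Uniform structures generated by a Hausdorff convergence\<close>

locale hausdorff_convergence =
  fixes Z :: "'a set" and \<Lambda> :: "'a \<Rightarrow> 'a filter set"
  assumes filters_on: "F \<in> \<Lambda> z \<Longrightarrow> F \<in> filters_on Z"
    and down: "F \<in> \<Lambda> z \<Longrightarrow> G \<le> F \<Longrightarrow> G \<noteq> bot \<Longrightarrow> G \<in> \<Lambda> z"
    and sup_in: "F \<in> \<Lambda> z \<Longrightarrow> G \<in> \<Lambda> z \<Longrightarrow> sup F G \<in> \<Lambda> z"
    and point_in: "z \<in> Z \<Longrightarrow> principal {z} \<in> \<Lambda> z"
    and unique: "z \<in> Z \<Longrightarrow> w \<in> Z \<Longrightarrow> F \<in> \<Lambda> z \<Longrightarrow> F \<in> \<Lambda> w \<Longrightarrow> z = w"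
begin

lemma SUP_in:
  assumes "finite I" "I \<noteq> {}" "\<And>i. i \<in> I \<Longrightarrow> \<F> i \<in> \<Lambda> z"
  shows "(SUP i\<in>I. \<F> i) \<in> \<Lambda> z"
  using assms by (induction I rule: finite_ne_induct) (auto intro: sup_in)

text \<open>Filters with distinct limits are disjoint, so the blocks \<open>P v \<times> P v\<close> below, which cover a
  member of \<open>F \<times> G\<close>, force both filters into one and the same block.\<close>

lemma prod_le_SUP_imp_common_limit:
  assumes I: "finite I" and u: "\<And>i. i \<in> I \<Longrightarrow> u i \<in> Z" "\<And>i. i \<in> I \<Longrightarrow> \<F> i \<in> \<Lambda> (u i)"
    and nb: "F \<noteq> bot" "G \<noteq> bot"
    and le: "F \<times>\<^sub>F G \<le> (SUP i\<in>I. \<F> i \<times>\<^sub>F \<F> i)"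
  shows "\<exists>z\<in>Z. F \<in> \<Lambda> z \<and> G \<in> \<Lambda> z"
proof -
  \<comment> \<open>Several \<open>u i\<close> may coincide, so the filters with equal limit are
    merged first and the blocks are indexed by distinct limits.\<close>
  define H where "H v = (SUP i\<in>{i\<in>I. u i = v}. \<F> i)" for v
  have H: "H v \<in> \<Lambda> v" if "v \<in> u ` I" for v
  proof -
    have "\<F> i \<in> \<Lambda> v" if "i \<in> I" "u i = v" for i
      using u(2)[OF that(1)] that(2) by simp
    then show ?thesis
      unfolding H_def using that I by (intro SUP_in) auto
  qed
  have "inf (H v) (H w) = bot" if "v \<in> u ` I" "w \<in> u ` I" "v \<noteq> w" for v w
    using that u(1) unique[of v w "inf (H v) (H w)"] down[OF H, of v "inf (H v) (H w)"]
      down[OF H, of w "inf (H v) (H w)"] by auto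
  then obtain P where P: "\<And>v. v \<in> u ` I \<Longrightarrow> eventually (P v) (H v)"
    "\<And>v w x. v \<in> u ` I \<Longrightarrow> w \<in> u ` I \<Longrightarrow> P v x \<Longrightarrow> P w x \<Longrightarrow> v = w"
    using finite_disjoint_filters[of "u ` I" H] I by blast
  \<comment> \<open>The parameter \<open>R\<close> lets the covering argument be used twice: with
    \<open>R\<close> trivial, to locate \<open>F\<close> and \<open>G\<close> in one block, and then
    with \<open>R\<close> a member of \<open>H v\<close> imposed on that block alone, to show that
    \<open>F\<close> and \<open>G\<close> are finer than \<open>H v\<close>.\<close>
  have block: "eventually (\<lambda>(x, y). \<exists>v\<in>u ` I. P v x \<and> R v x \<and> P v y \<and> R v y) (F \<times>\<^sub>F G)"
    if R: "\<And>v. v \<in> u ` I \<Longrightarrow> eventually (R v) (H v)" for R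
  proof -
    have "eventually (\<lambda>(x, y). \<exists>v\<in>u ` I. P v x \<and> R v x \<and> P v y \<and> R v y) (\<F> i \<times>\<^sub>F \<F> i)"
      if "i \<in> I" for i
    proof -
      have "\<F> i \<le> H (u i)"
        unfolding H_def using that by (intro SUP_upper) auto
      then have ev: "eventually (\<lambda>x. P (u i) x \<and> R (u i) x) (\<F> i)"
        using P(1) R that by (auto simp: le_filter_def intro!: eventually_conj)
      show ?thesis
        by (rule eventually_mono[OF eventually_prodI[OF ev ev]]) (use that in auto)
    qed
    then have "eventually (\<lambda>(x, y). \<exists>v\<in>u ` I. P v x \<and> R v x \<and> P v y \<and> R v y)
        (SUP i\<in>I. \<F> i \<times>\<^sub>F \<F> i)"
      by (simp add: eventually_Sup)
    with le show ?thesis by (rule filter_leD)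
  qed
  obtain B C where BC: "eventually B F" "eventually C G"
    and cover: "\<And>x y. B x \<Longrightarrow> C y \<Longrightarrow> \<exists>v\<in>u ` I. P v x \<and> P v y"
    using block[of "\<lambda>_ _. True"] by (auto simp: eventually_prod_filter)
  obtain x y where "B x" "C y"
    using eventually_happens'[OF nb(1) BC(1)] eventually_happens'[OF nb(2) BC(2)] by blast
  with cover obtain v where v: "v \<in> u ` I" "P v x" "P v y" by blast
  have BP: "P v x'" if "B x'" for x'
    using cover[OF that \<open>C y\<close>] v P(2) by metis
  have CP: "P v y'" if "C y'" for y'
    using cover[OF \<open>B x\<close> that] v P(2) by metis
  have "eventually R F \<and> eventually R G" if R: "eventually R (H v)" for R
  proof -
    have "eventually (\<lambda>(x, y). \<exists>w\<in>u ` I. P w x \<and> (w = v \<longrightarrow> R x) \<and> P w y \<and> (w = v \<longrightarrow> R y))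
        (F \<times>\<^sub>F G)"
      using R by (intro block) auto
    moreover have "eventually (\<lambda>p. B (fst p) \<and> C (snd p)) (F \<times>\<^sub>F G)"
      using BC by (rule eventually_prodI)
    ultimately have "eventually (\<lambda>p. R (fst p) \<and> R (snd p)) (F \<times>\<^sub>F G)"
    proof eventually_elim
      case (elim p)
      then obtain w where w: "w \<in> u ` I" "P w (fst p)" "w = v \<longrightarrow> R (fst p)" "w = v \<longrightarrow> R (snd p)"
        by (auto simp: case_prod_beta)
      have "w = v" using P(2)[OF w(1) v(1) w(2)] BP elim by blast
      with w show ?case by blast
    qed
    then have "eventually (\<lambda>(x, y). R x) (F \<times>\<^sub>F G)" "eventually (\<lambda>(x, y). R y) (F \<times>\<^sub>F G)"
      by (auto elim: eventually_mono)
    then show ?thesis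
      by (simp add: eventually_prod1 eventually_prod2 nb)
  qed
  then have "F \<le> H v" "G \<le> H v" by (auto simp: le_filter_def)
  then show ?thesis
    using down[OF H[OF v(1)]] nb u(1) v(1) by blast
qed

sublocale complete_hausdorff_ucs Z "ucs_of_convergence Z \<Lambda>" \<Lambda>
proof
  show "F \<times>\<^sub>F G \<in> ucs_of_convergence Z \<Lambda> \<longleftrightarrow> (\<exists>z\<in>Z. F \<in> \<Lambda> z \<and> G \<in> \<Lambda> z)" for F G
  proof
    assume "F \<times>\<^sub>F G \<in> ucs_of_convergence Z \<Lambda>"
    then obtain k u \<F> where "\<forall>i\<in>{1..k::nat}. u i \<in> Z \<and> \<F> i \<in> \<Lambda> (u i)"
      "F \<times>\<^sub>F G \<le> (SUP i\<in>{1..k}. \<F> i \<times>\<^sub>F \<F> i)" "F \<in> filters_on Z" "G \<in> filters_on Z"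
      unfolding ucs_of_convergence_def by (auto simp: filters_on_Times_iff)
    then show "\<exists>z\<in>Z. F \<in> \<Lambda> z \<and> G \<in> \<Lambda> z"
      by (intro prod_le_SUP_imp_common_limit[of "{1..k}" u \<F>]) (auto simp: filters_on_def)
  next
    assume "\<exists>z\<in>Z. F \<in> \<Lambda> z \<and> G \<in> \<Lambda> z"
    then obtain z where z: "z \<in> Z" "F \<in> \<Lambda> z" "G \<in> \<Lambda> z" by blast
    have "\<exists>k\<ge>1::nat. \<exists>u \<F>. (\<forall>i\<in>{1..k}. u i \<in> Z \<and> \<F> i \<in> \<Lambda> (u i)) \<and>
          F \<times>\<^sub>F G \<le> (SUP i\<in>{1..k}. \<F> i \<times>\<^sub>F \<F> i)"
      by (intro exI[of _ 1] conjI exI[of _ "\<lambda>_. z"] exI[of _ "\<lambda>_. sup F G"])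
        (auto simp: z sup_in prod_filter_mono)
    then show "F \<times>\<^sub>F G \<in> ucs_of_convergence Z \<Lambda>"
      using z by (simp add: ucs_of_convergence_def filters_on_Times_iff filters_on)
  qed
qed (fact sup_in down point_in unique)+

end

text \<open>The projections turn a product of filters on pairs into products of projected filters.
  Membership in \<open>K\<close> thus yields one common limit per component, and the two form the
  limit in the product.\<close>

lemma complete_hausdorff_ucs_prod:
  assumes "complete_hausdorff_ucs Z J \<Lambda>" "complete_hausdorff_ucs Z' J' \<Lambda>'"
  defines "K \<equiv> {\<V> \<in> filters_on ((Z \<times> Z') \<times> (Z \<times> Z')).
      filtermap (map_prod fst fst) \<V> \<in> J \<and> filtermap (map_prod snd snd) \<V> \<in> J'}"
  defines "M \<equiv> \<lambda>z. {F \<in> filters_on (Z \<times> Z').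
      filtermap fst F \<in> \<Lambda> (fst z) \<and> filtermap snd F \<in> \<Lambda>' (snd z)}"
  shows "complete_hausdorff_ucs (Z \<times> Z') K M"
proof -
  interpret A: complete_hausdorff_ucs Z J \<Lambda> by fact
  interpret B: complete_hausdorff_ucs Z' J' \<Lambda>' by fact
  show ?thesis
  proof
    show "sup F G \<in> M z" if "F \<in> M z" "G \<in> M z" for F G z
      using that by (auto simp: M_def filters_on_def filtermap_sup A.sup_in B.sup_in)
    show "G \<in> M z" if "F \<in> M z" "G \<le> F" "G \<noteq> bot" for F G z
      using that by (auto simp: M_def filters_on_def filtermap_bot_iff
          intro: A.down B.down filtermap_mono)
    show "principal {z} \<in> M z" if "z \<in> Z \<times> Z'" for z
      using that by (auto simp: M_def filters_on_def A.point_in B.point_in principal_eq_bot_iff)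
    show "z = w" if "z \<in> Z \<times> Z'" "w \<in> Z \<times> Z'" "F \<in> M z" "F \<in> M w" for z w F
      using that A.unique[of "fst z" "fst w" "filtermap fst F"]
        B.unique[of "snd z" "snd w" "filtermap snd F"] by (auto simp: M_def)
    show "F \<times>\<^sub>F G \<in> K \<longleftrightarrow> (\<exists>z\<in>Z \<times> Z'. F \<in> M z \<and> G \<in> M z)" for F G
      by (auto simp: K_def M_def filters_on_Times_iff filtermap_map_prod_prod_filter
          A.prod_in_iff B.prod_in_iff)
  qed
qed

section \<open>Baire operators\<close>

lemma baire_S_le:
  "x \<in> \<Omega> \<Longrightarrow> \<delta> > 0 \<Longrightarrow> baire_S \<Omega> D u x \<le> (SUP y\<in>ball x \<delta> \<inter> D. u y)"
  by (auto simp: baire_S_def intro!: INF_lower)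

lemma le_baire_I:
  "x \<in> \<Omega> \<Longrightarrow> \<delta> > 0 \<Longrightarrow> (INF y\<in>ball x \<delta> \<inter> D. u y) \<le> baire_I \<Omega> D u x"
  unfolding baire_I_def by (auto intro!: SUP_upper)

lemma le_baire_S_iff:
  "x \<in> \<Omega> \<Longrightarrow> c \<le> baire_S \<Omega> D u x \<longleftrightarrow> (\<forall>\<delta>>0. c \<le> (SUP y\<in>ball x \<delta> \<inter> D. u y))"
  by (auto simp: baire_S_def le_INF_iff)

lemma baire_I_le_iff:
  "x \<in> \<Omega> \<Longrightarrow> baire_I \<Omega> D u x \<le> c \<longleftrightarrow> (\<forall>\<delta>>0. (INF y\<in>ball x \<delta> \<inter> D. u y) \<le> c)"
  by (auto simp: baire_I_def SUP_le_iff)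

lemma le_baire_S: "x \<in> \<Omega> \<Longrightarrow> x \<in> D \<Longrightarrow> u x \<le> baire_S \<Omega> D u x"
  by (auto simp: baire_S_def intro!: INF_greatest SUP_upper)

lemma baire_I_le: "x \<in> \<Omega> \<Longrightarrow> x \<in> D \<Longrightarrow> baire_I \<Omega> D u x \<le> u x"
  by (auto simp: baire_I_def intro!: SUP_least INF_lower)

lemma baire_S_mono:
  "x \<in> \<Omega> \<Longrightarrow> (\<And>y. y \<in> D \<Longrightarrow> u y \<le> v y) \<Longrightarrow> baire_S \<Omega> D u x \<le> baire_S \<Omega> D v x"
  by (auto simp: baire_S_def intro!: INF_mono' SUP_subset_mono)

lemma baire_I_mono:
  "x \<in> \<Omega> \<Longrightarrow> (\<And>y. y \<in> D \<Longrightarrow> u y \<le> v y) \<Longrightarrow> baire_I \<Omega> D u x \<le> baire_I \<Omega> D v x"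
  by (auto simp: baire_I_def intro!: SUP_mono' INF_superset_mono)

lemma ball_shrink:
  assumes "y \<in> ball x \<delta>"
  shows "\<delta> - dist x y > 0" and "ball y (\<delta> - dist x y) \<subseteq> ball x \<delta>"
proof -
  show "\<delta> - dist x y > 0" using assms by simp
  show "ball y (\<delta> - dist x y) \<subseteq> ball x \<delta>"
  proof
    fix z assume "z \<in> ball y (\<delta> - dist x y)"
    then show "z \<in> ball x \<delta>" using dist_triangle[of x z y] by simp
  qed
qed

text \<open>Every point of a ball about \<open>x\<close> has a smaller ball inside it, so the
  supremum over the large ball already bounds \<open>baire_S\<close> at that point.\<close>

lemma baire_S_idem:
  assumes "x \<in> \<Omega>"
  shows "baire_S \<Omega> \<Omega> (baire_S \<Omega> D u) x \<le> baire_S \<Omega> D u x"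
proof -
  have "baire_S \<Omega> \<Omega> (baire_S \<Omega> D u) x \<le> (SUP y\<in>ball x \<delta> \<inter> D. u y)" if "\<delta> > 0" for \<delta>
  proof (rule order_trans[OF baire_S_le[OF assms that]], rule SUP_least)
    fix y assume y: "y \<in> ball x \<delta> \<inter> \<Omega>"
    then have "baire_S \<Omega> D u y \<le> (SUP z\<in>ball y (\<delta> - dist x y) \<inter> D. u z)"
      by (intro baire_S_le) auto
    also have "\<dots> \<le> (SUP z\<in>ball x \<delta> \<inter> D. u z)"
      using y ball_shrink(2)[of y x \<delta>] by (intro SUP_subset_mono) auto
    finally show "baire_S \<Omega> D u y \<le> (SUP z\<in>ball x \<delta> \<inter> D. u z)" .
  qed
  then show ?thesis
    using assms by (simp add: le_baire_S_iff)
qed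

lemma baire_I_idem:
  assumes "x \<in> \<Omega>"
  shows "baire_I \<Omega> D u x \<le> baire_I \<Omega> \<Omega> (baire_I \<Omega> D u) x"
proof -
  have "(INF y\<in>ball x \<delta> \<inter> D. u y) \<le> baire_I \<Omega> \<Omega> (baire_I \<Omega> D u) x" if "\<delta> > 0" for \<delta>
  proof (rule order_trans[OF _ le_baire_I[OF assms that]], rule INF_greatest)
    fix y assume y: "y \<in> ball x \<delta> \<inter> \<Omega>"
    have "(INF z\<in>ball x \<delta> \<inter> D. u z) \<le> (INF z\<in>ball y (\<delta> - dist x y) \<inter> D. u z)"
      using y ball_shrink(2)[of y x \<delta>] by (intro INF_superset_mono) auto
    also have "\<dots> \<le> baire_I \<Omega> D u y"
      using y by (intro le_baire_I) auto
    finally show "(INF z\<in>ball x \<delta> \<inter> D. u z) \<le> baire_I \<Omega> D u y" .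
  qed
  then show ?thesis
    using assms by (simp add: baire_I_le_iff)
qed

text \<open>Makes every regularised function a candidate for \<open>ML0\<close>. Putting I below the
  identity gives I S I S \<le> I S S, putting S above it gives I I S \<le> I S I S, and the
  idempotence bounds close both ends.\<close>

lemma normal_lsc_baire: "normal_lsc \<Omega> (baire_I \<Omega> \<Omega> (baire_S \<Omega> D u))"
  unfolding normal_lsc_def
proof (intro ballI antisym)
  fix x assume x: "x \<in> \<Omega>"
  let ?S = "baire_S \<Omega> D u" and ?I = "baire_I \<Omega> \<Omega>"
  have "?I (baire_S \<Omega> \<Omega> (?I ?S)) x \<le> ?I (baire_S \<Omega> \<Omega> ?S) x"
    by (intro baire_I_mono baire_S_mono baire_I_le x)
  also have "\<dots> \<le> ?I ?S x"
    by (intro baire_I_mono baire_S_idem x)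
  finally show "?I (baire_S \<Omega> \<Omega> (?I ?S)) x \<le> ?I ?S x" .
  have "?I ?S x \<le> ?I (?I ?S) x" by (intro baire_I_idem x)
  also have "\<dots> \<le> ?I (baire_S \<Omega> \<Omega> (?I ?S)) x"
    by (intro baire_I_mono le_baire_S x)
  finally show "?I ?S x \<le> ?I (baire_S \<Omega> \<Omega> (?I ?S)) x" .
qed

section \<open>Values at continuity points, and uniqueness of normal functions\<close>

lemma eventually_small_ball:
  fixes u :: "'a::metric_space \<Rightarrow> 'b::order_topology"
  assumes "open W" "z \<in> W" "continuous_on W u"
  shows "c < u z \<Longrightarrow> \<exists>\<delta>>0. \<forall>y\<in>ball z \<delta>. c < u y"
    and "u z < c \<Longrightarrow> \<exists>\<delta>>0. \<forall>y\<in>ball z \<delta>. u y < c"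
proof -
  have "(u \<longlongrightarrow> u z) (nhds z)"
    using assms by (metis continuous_on_eq_continuous_at isCont_def tendsto_at_iff_tendsto_nhds)
  then have "c < u z \<Longrightarrow> \<forall>\<^sub>F y in nhds z. c < u y" "u z < c \<Longrightarrow> \<forall>\<^sub>F y in nhds z. u y < c"
    by (auto dest: order_tendstoD)
  then show "c < u z \<Longrightarrow> \<exists>\<delta>>0. \<forall>y\<in>ball z \<delta>. c < u y"
    and "u z < c \<Longrightarrow> \<exists>\<delta>>0. \<forall>y\<in>ball z \<delta>. u y < c"
    by (auto simp: eventually_nhds_metric dist_commute)
qed

lemma baire_S_eq_at_continuity:
  assumes W: "open W" "z \<in> W" "W \<subseteq> \<Omega>" "W \<subseteq> D" and u: "continuous_on W u"
  shows "baire_S \<Omega> D u z = u z"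
proof (rule antisym)
  show "u z \<le> baire_S \<Omega> D u z" using W by (auto intro: le_baire_S)
  show "baire_S \<Omega> D u z \<le> u z"
  proof (rule ccontr)
    assume "\<not> ?thesis"
    then obtain c where c: "u z < c" "c < baire_S \<Omega> D u z"
      using dense by (meson not_le)
    obtain \<delta> where "\<delta> > 0" "\<forall>y\<in>ball z \<delta>. u y < c"
      using eventually_small_ball(2)[OF W(1,2) u c(1)] by blast
    then have "(SUP y\<in>ball z \<delta> \<inter> D. u y) \<le> c"
      by (intro SUP_least) (auto intro: less_imp_le)
    with baire_S_le[of z \<Omega> \<delta> D u] \<open>\<delta> > 0\<close> W c show False by auto
  qed
qed

lemma baire_I_eq_at_continuity:
  assumes W: "open W" "z \<in> W" "W \<subseteq> \<Omega>" "W \<subseteq> D" and u: "continuous_on W u"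
  shows "baire_I \<Omega> D u z = u z"
proof (rule antisym)
  show "baire_I \<Omega> D u z \<le> u z" using W by (auto intro: baire_I_le)
  show "u z \<le> baire_I \<Omega> D u z"
  proof (rule ccontr)
    assume "\<not> ?thesis"
    then obtain c where c: "c < u z" "baire_I \<Omega> D u z < c"
      using dense by (meson not_le)
    obtain \<delta> where "\<delta> > 0" "\<forall>y\<in>ball z \<delta>. c < u y"
      using eventually_small_ball(1)[OF W(1,2) u c(1)] by blast
    then have "c \<le> (INF y\<in>ball z \<delta> \<inter> D. u y)"
      by (intro INF_greatest) (auto intro: less_imp_le)
    with le_baire_I[of z \<Omega> \<delta> u D] \<open>\<delta> > 0\<close> W c show False by auto
  qed
qed

lemma baire_I_S_eq_at_continuity:
  assumes W: "open W" "z \<in> W" "W \<subseteq> \<Omega>" "W \<subseteq> D" and u: "continuous_on W u"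
  shows "baire_I \<Omega> \<Omega> (baire_S \<Omega> D u) z = u z"
proof -
  have eq: "baire_S \<Omega> D u y = u y" if "y \<in> W" for y
    using baire_S_eq_at_continuity[OF W(1) that W(3,4) u] .
  then have "continuous_on W (baire_S \<Omega> D u)"
    using u continuous_on_cong by metis
  then show ?thesis
    using baire_I_eq_at_continuity[OF W(1-3)] W eq by simp
qed

text \<open>An upper semi-continuous function has the same infimum over an open set and over a dense
  subset of it; this applies to \<open>S u\<close>, whose values on an open set depend on \<open>u\<close> there only.\<close>

lemma normal_lsc_le_if_eq_on_dense:
  assumes u: "normal_lsc \<Omega> u" and v: "normal_lsc \<Omega> v"
    and D: "open D" "D \<subseteq> \<Omega>" "\<Omega> \<subseteq> closure D" and eq: "\<And>z. z \<in> D \<Longrightarrow> u z = v z"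
    and z: "z \<in> \<Omega>"
  shows "u z \<le> v z"
proof -
  have S_le: "baire_S \<Omega> \<Omega> u x \<le> baire_S \<Omega> \<Omega> v x" if x: "x \<in> D" for x
  proof -
    obtain \<epsilon> where \<epsilon>: "\<epsilon> > 0" "ball x \<epsilon> \<subseteq> D"
      using D(1) x open_contains_ball by blast
    have "baire_S \<Omega> \<Omega> u x \<le> (SUP y\<in>ball x \<delta> \<inter> \<Omega>. v y)" if "\<delta> > 0" for \<delta>
    proof -
      have "baire_S \<Omega> \<Omega> u x \<le> (SUP y\<in>ball x (min \<delta> \<epsilon>) \<inter> \<Omega>. u y)"
        using x D(2) \<epsilon>(1) that by (intro baire_S_le) auto
      also have "\<dots> = (SUP y\<in>ball x (min \<delta> \<epsilon>) \<inter> \<Omega>. v y)"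
        using \<epsilon>(2) eq by (intro SUP_cong) auto
      also have "\<dots> \<le> (SUP y\<in>ball x \<delta> \<inter> \<Omega>. v y)"
        by (intro SUP_subset_mono) auto
      finally show ?thesis .
    qed
    then show ?thesis
      using x D(2) by (auto simp: le_baire_S_iff)
  qed
  \<comment> \<open>Were S v at \<open>y\<close> below the infimum \<open>?c\<close>, some ball
    about \<open>y\<close> would bound v strictly below \<open>?c\<close>; density puts a point
    \<open>p\<close> of \<open>D\<close> into it, where S u \<le> S v gives a contradiction.\<close>
  have INF_le: "(INF y\<in>ball z \<delta> \<inter> \<Omega>. baire_S \<Omega> \<Omega> u y) \<le> baire_S \<Omega> \<Omega> v y"
    (is "?c \<le> _") if y: "y \<in> ball z \<delta> \<inter> \<Omega>" for \<delta> y
  proof (rule ccontr)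
    assume "\<not> ?thesis"
    then have "(INF \<epsilon>\<in>{0<..}. SUP y\<in>ball y \<epsilon> \<inter> \<Omega>. v y) < ?c"
      using y by (simp add: baire_S_def[of _ _ v] not_le)
    then obtain \<epsilon> where \<epsilon>: "\<epsilon> > 0" "(SUP y\<in>ball y \<epsilon> \<inter> \<Omega>. v y) < ?c"
      unfolding INF_less_iff by auto
    have "\<delta> - dist z y > 0" using y ball_shrink(1)[of y z \<delta>] by simp
    then obtain p where p: "p \<in> D" "dist p y < min \<epsilon> (\<delta> - dist z y)"
      using y D(3) \<epsilon>(1) by (meson IntD2 closure_approachable min_less_iff_conj subsetD)
    then have "p \<in> ball y (\<delta> - dist z y)" by (simp add: dist_commute)
    then have p': "p \<in> ball y \<epsilon>" "p \<in> ball z \<delta>"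
      using ball_shrink(2)[of y z \<delta>] y p(2) by (simp add: dist_commute, blast)
    have "?c \<le> baire_S \<Omega> \<Omega> u p"
      using p p' D(2) by (intro INF_lower) auto
    also have "\<dots> \<le> baire_S \<Omega> \<Omega> v p" using S_le p by simp
    also have "\<dots> \<le> (SUP x\<in>ball p (\<epsilon> - dist y p) \<inter> \<Omega>. v x)"
      using p p' D(2) ball_shrink(1) by (intro baire_S_le) auto
    also have "\<dots> \<le> (SUP y\<in>ball y \<epsilon> \<inter> \<Omega>. v y)"
      using ball_shrink(2)[OF p'(1)] by (intro SUP_subset_mono) auto
    finally show False using \<epsilon>(2) by simp
  qed
  have "baire_I \<Omega> \<Omega> (baire_S \<Omega> \<Omega> u) z \<le> baire_I \<Omega> \<Omega> (baire_S \<Omega> \<Omega> v) z"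
    using z by (auto simp: baire_I_def intro!: SUP_mono' INF_greatest INF_le)
  then show ?thesis
    using u v z by (simp add: normal_lsc_def)
qed

lemma normal_lsc_eq_if_eq_on_dense:
  assumes "normal_lsc \<Omega> u" "normal_lsc \<Omega> v" "open D" "D \<subseteq> \<Omega>" "\<Omega> \<subseteq> closure D"
    "\<And>z. z \<in> D \<Longrightarrow> u z = v z" "z \<in> \<Omega>"
  shows "u z = v z"
  using normal_lsc_le_if_eq_on_dense[OF assms(1-5) _ assms(7)]
    normal_lsc_le_if_eq_on_dense[OF assms(2,1,3-5) _ assms(7)] assms(6) by (metis antisym)

section \<open>The spaces of the Cauchy problem\<close>

lemma open_Omega: "open (Omega a b)"
  by (simp add: Omega_def open_Times)

lemma open_subset_closure_Diff_negligible:
  fixes \<Omega> :: "'a::euclidean_space set"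
  assumes "open \<Omega>" "negligible N"
  shows "\<Omega> \<subseteq> closure (\<Omega> - N)"
proof
  fix x assume x: "x \<in> \<Omega>"
  show "x \<in> closure (\<Omega> - N)"
    unfolding closure_approachable
  proof (intro allI impI)
    fix e :: real assume "e > 0"
    then have "x \<in> ball x e \<inter> \<Omega>" using x by simp
    then have "\<not> negligible (ball x e \<inter> \<Omega>)"
      using assms(1) by (intro open_not_negligible) blast+
    then have "\<not> ball x e \<inter> \<Omega> \<subseteq> N"
      using assms(2) negligible_subset by blast
    then show "\<exists>y\<in>\<Omega> - N. dist y x < e"
      by (auto simp: dist_commute)
  qed
qed

lemma negligible_imp_interior_empty:
  fixes N :: "'a::euclidean_space set"
  shows "negligible N \<Longrightarrow> interior N = {}"
  using interior_subset negligible_subset open_interior open_not_negligible by metis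

text \<open>The set of disagreement is open because the target is Hausdorff, and an open null set is
  empty.\<close>

lemma eq_on_open_if_eq_off_negligible:
  fixes u v :: "'a::euclidean_space \<Rightarrow> 'b::t2_space"
  assumes "open D" "continuous_on D u" "continuous_on D v" "negligible E"
    and eq: "\<And>z. z \<in> D - E \<Longrightarrow> u z = v z" and z: "z \<in> D"
  shows "u z = v z"
proof -
  let ?N = "D \<inter> (\<lambda>x. (u x, v x)) -` {p. fst p \<noteq> snd p}"
  have "open {p::'b \<times> 'b. fst p \<noteq> snd p}"
    by (intro open_Collect_neq continuous_intros)
  then have "open ?N"
    using assms by (intro continuous_open_preimage continuous_on_Pair)
  moreover have "?N \<subseteq> E" using eq by auto
  ultimately have "?N = {}"
    using assms(4) negligible_subset open_not_negligible by metis
  with z show ?thesis by auto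
qed

lemma Cm_on_imp_continuous_on: "Cm_on m W f \<Longrightarrow> continuous_on W f"
  by (cases m) auto

lemma singular_setD:
  assumes "open \<Omega>" "singular_set m \<Omega> u \<Gamma>"
  shows "open (\<Omega> - \<Gamma>)" "negligible \<Gamma>" "continuous_on (\<Omega> - \<Gamma>) u"
proof -
  obtain C where "closed C" "\<Gamma> = \<Omega> \<inter> C"
    using assms(2) by (auto simp: singular_set_def closedin_closed)
  then have "\<Omega> - \<Gamma> = \<Omega> - C" by auto
  with assms(1) \<open>closed C\<close> show "open (\<Omega> - \<Gamma>)" by auto
  show "negligible \<Gamma>" using assms(2) by (simp add: singular_set_def negligible_iff_null_sets)
  have "continuous_on (\<Omega> - \<Gamma>) (\<lambda>z. ereal (real_of_ereal (u z)))"
    using assms(2) by (auto simp: singular_set_def intro!: continuous_intros Cm_on_imp_continuous_on)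
  then show "continuous_on (\<Omega> - \<Gamma>) u"
    by (rule continuous_on_eq) (use assms(2) in \<open>auto simp: singular_set_def ereal_real\<close>)
qed

text \<open>This is why \<open>conv_a\<close> has unique limits although it ignores null sets.
  Equality spreads by continuity from almost everywhere to the common open set of regularity, and by
  normality from that dense set to all of \<Omega>.\<close>

lemma ML0_eq_if_eq_off_negligible:
  assumes \<Omega>: "open \<Omega>" and u: "u \<in> ML0 m \<Omega>" and v: "v \<in> ML0 n \<Omega>"
    and E: "negligible E" "\<And>z. z \<in> \<Omega> - E \<Longrightarrow> u z = v z"
  shows "u = v"
proof -
  obtain \<Gamma> \<Gamma>' where \<Gamma>: "singular_set m \<Omega> u \<Gamma>" "singular_set n \<Omega> v \<Gamma>'"
    using u v by (auto simp: ML0_def)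
  note s = singular_setD[OF \<Omega> \<Gamma>(1)] singular_setD[OF \<Omega> \<Gamma>(2)]
  define D where "D = (\<Omega> - \<Gamma>) \<inter> (\<Omega> - \<Gamma>')"
  have D: "open D" "D \<subseteq> \<Omega>" using s by (auto simp: D_def)
  have "D = \<Omega> - (\<Gamma> \<union> \<Gamma>')" by (auto simp: D_def)
  then have dense: "\<Omega> \<subseteq> closure D"
    using open_subset_closure_Diff_negligible[OF \<Omega>] s by (simp add: negligible_Un)
  have "u z = v z" if "z \<in> D" for z
  proof (rule eq_on_open_if_eq_off_negligible[OF D(1) _ _ E(1) _ that])
    show "continuous_on D u" "continuous_on D v"
      using s by (auto simp: D_def intro: continuous_on_subset)
  qed (use E D in auto)
  then have "u z = v z" if "z \<in> \<Omega>" for z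
    using normal_lsc_eq_if_eq_on_dense[OF _ _ D dense _ that] u v by (auto simp: ML0_def)
  with u v show ?thesis by (auto simp: ML0_def intro: extensionalityI)
qed

lemma hausdorff_convergence_conv_a:
  assumes \<Omega>: "open \<Omega>"
  shows "hausdorff_convergence (ML0 0 \<Omega>) (conv_a \<Omega>)"
proof
  show "F \<in> filters_on (ML0 0 \<Omega>)" if "F \<in> conv_a \<Omega> u" for F u
    using that by (simp add: conv_a_def)
  show "G \<in> conv_a \<Omega> u" if "F \<in> conv_a \<Omega> u" "G \<le> F" "G \<noteq> bot" for F G u
    using that unfolding conv_a_def filters_on_def
    by (simp, meson order_trans tendsto_mono)
  show "sup F G \<in> conv_a \<Omega> u" if F: "F \<in> conv_a \<Omega> u" and G: "G \<in> conv_a \<Omega> u" for F G u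
  proof -
    obtain E E' where "E \<subseteq> \<Omega>" "E \<in> null_sets lebesgue" "\<forall>z\<in>\<Omega> - E. ((\<lambda>v. v z) \<longlongrightarrow> u z) F"
      "E' \<subseteq> \<Omega>" "E' \<in> null_sets lebesgue" "\<forall>z\<in>\<Omega> - E'. ((\<lambda>v. v z) \<longlongrightarrow> u z) G"
      using F G by (auto simp: conv_a_def)
    then have "E \<union> E' \<subseteq> \<Omega> \<and> E \<union> E' \<in> null_sets lebesgue \<and>
        (\<forall>z\<in>\<Omega> - (E \<union> E'). ((\<lambda>v. v z) \<longlongrightarrow> u z) (sup F G))"
      by (auto intro: filterlim_sup null_sets.Un)
    moreover have "sup F G \<in> filters_on (ML0 0 \<Omega>)"
      using F G by (auto simp: conv_a_def filters_on_def)
    ultimately show ?thesis unfolding conv_a_def by blast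
  qed
  show "principal {u} \<in> conv_a \<Omega> u" if "u \<in> ML0 0 \<Omega>" for u
  proof -
    have "\<forall>z\<in>\<Omega> - {}. ((\<lambda>v. v z) \<longlongrightarrow> u z) (principal {u})"
      by (simp add: tendsto_def eventually_principal)
    then show ?thesis
      using that unfolding conv_a_def filters_on_def
      by (auto simp: principal_eq_bot_iff intro!: exI[of _ "{}"])
  qed
  show "u = v" if u: "u \<in> ML0 0 \<Omega>" and v: "v \<in> ML0 0 \<Omega>"
    and F: "F \<in> conv_a \<Omega> u" "F \<in> conv_a \<Omega> v" for u v F
  proof -
    obtain E E' where E: "negligible E" "\<forall>z\<in>\<Omega> - E. ((\<lambda>v. v z) \<longlongrightarrow> u z) F"
      "negligible E'" "\<forall>z\<in>\<Omega> - E'. ((\<lambda>v. v z) \<longlongrightarrow> v z) F"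
      using F by (auto simp: conv_a_def negligible_iff_null_sets)
    have "F \<noteq> bot" using F by (auto simp: conv_a_def filters_on_def)
    then have "u z = v z" if "z \<in> \<Omega> - (E \<union> E')" for z
      using that E by (intro tendsto_unique[of F "\<lambda>v. v z"]) auto
    then show ?thesis
      using ML0_eq_if_eq_off_negligible[OF \<Omega> u v] E by (metis negligible_Un)
  qed
qed

lemma hausdorff_convergence_conv_0: "hausdorff_convergence (C1_interval a) (conv_0 a)"
proof
  show "f = g" if "F \<in> conv_0 a f" "F \<in> conv_0 a g" for f g F
  proof -
    have "eventually (\<lambda>h. h = f \<and> h = g) F" "F \<noteq> bot"
      using that by (auto simp: conv_0_def filters_on_def le_principal intro: eventually_conj)
    then show ?thesis using eventually_happens' by blast
  qed
qed (simp_all add: conv_0_def filters_on_def principal_eq_bot_iff order_trans)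

definition conv_Y where
  "conv_Y a b = (\<lambda>z. {F \<in> filters_on (Y_space a b).
     filtermap fst F \<in> conv_a (Omega a b) (fst z) \<and> filtermap snd F \<in> conv_0 a (snd z)})"

lemma complete_hausdorff_ucs_Y:
  "complete_hausdorff_ucs (Y_space a b) (ucs_Y a b) (conv_Y a b)"
proof -
  interpret A: hausdorff_convergence "ML0 0 (Omega a b)" "conv_a (Omega a b)"
    by (rule hausdorff_convergence_conv_a[OF open_Omega])
  interpret B: hausdorff_convergence "C1_interval a" "conv_0 a"
    by (rule hausdorff_convergence_conv_0)
  show ?thesis
    unfolding conv_Y_def ucs_Y_def Y_space_def ucs_a_def ucs_0_def
    by (rule complete_hausdorff_ucs_prod[OF A.complete_hausdorff_ucs_axioms
          B.complete_hausdorff_ucs_axioms])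
qed

section \<open>Locality of partial derivatives and of C^m\<close>

lemma eventually_nhds_slices:
  assumes "eventually P (nhds (x, y))"
  shows "eventually (\<lambda>s. P (s, y)) (nhds x)" "eventually (\<lambda>t. P (x, t)) (nhds y)"
proof -
  obtain Q R where "eventually Q (nhds x)" "eventually R (nhds y)" and P: "\<And>s t. Q s \<Longrightarrow> R t \<Longrightarrow> P (s, t)"
    using assms unfolding nhds_prod eventually_prod_filter by blast
  moreover from this have "Q x" "R y" by (auto dest: eventually_nhds_x_imp_x)
  ultimately show "eventually (\<lambda>s. P (s, y)) (nhds x)" "eventually (\<lambda>t. P (x, t)) (nhds y)"
    by (auto elim!: eventually_mono)
qed

lemma partial_cong_ev:
  assumes "eventually (\<lambda>z. f z = g z) (nhds z)"
  shows "partial_x f z = partial_x g z" "partial_y f z = partial_y g z"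
proof -
  obtain x y where z: "z = (x, y)" by (cases z)
  note ev = eventually_nhds_slices[OF assms[unfolded z]]
  show "partial_x f z = partial_x g z" "partial_y f z = partial_y g z"
    using deriv_cong_ev[OF ev(1) refl] deriv_cong_ev[OF ev(2) refl]
    by (simp_all add: z partial_x_def partial_y_def)
qed

lemma field_differentiable_cong_ev:
  assumes "eventually (\<lambda>x. f x = g x) (nhds x)"
  shows "f field_differentiable at x \<longleftrightarrow> g field_differentiable at x"
  by (simp add: field_differentiable_def DERIV_cong_ev[OF refl assms refl])

text \<open>Partial derivatives see only the germ of a function, so local representatives
  differentiate to local representatives. This glues smoothness over cells with different formulas
  and transfers it to regularised functions.\<close>

lemma Cm_on_local:
  assumes "\<And>z. z \<in> W \<Longrightarrow> \<exists>V g. open V \<and> z \<in> V \<and> Cm_on m V g \<and> (\<forall>y\<in>V. f y = g y)"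
  shows "Cm_on m W f"
  using assms
proof (induction m arbitrary: f)
  have cont: "continuous_on W f"
    if loc: "\<And>z. z \<in> W \<Longrightarrow> \<exists>V g. open V \<and> z \<in> V \<and> continuous_on V g \<and> (\<forall>y\<in>V. f y = g y)"
    for f :: "real \<times> real \<Rightarrow> real"
  proof -
    have "isCont f z" if z: "z \<in> W" for z
    proof -
      obtain V g where V: "open V" "z \<in> V" "continuous_on V g" "\<forall>y\<in>V. f y = g y"
        using loc[OF z] by metis
      have "continuous_on V f" by (rule continuous_on_eq[OF V(3)]) (simp add: V(4))
      with V(1,2) show ?thesis by (simp add: continuous_on_eq_continuous_at)
    qed
    then show ?thesis by (simp add: continuous_at_imp_continuous_on)
  qed
  {
    case 0
    then show ?case using cont by simp
  next
    case (Suc m)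
    have eq: "partial_x f y = partial_x g y" "partial_y f y = partial_y g y"
      "eventually (\<lambda>z. f z = g z) (nhds y)"
      if "open V" "\<forall>y\<in>V. f y = g y" "y \<in> V" for V g y
    proof -
      show "eventually (\<lambda>z. f z = g z) (nhds y)"
        using that unfolding eventually_nhds by blast
      then show "partial_x f y = partial_x g y" "partial_y f y = partial_y g y"
        by (auto intro: partial_cong_ev)
    qed
    have "continuous_on W f"
    proof (rule cont)
      fix z assume "z \<in> W"
      then obtain V g where "open V" "z \<in> V" "Cm_on (Suc m) V g" "\<forall>y\<in>V. f y = g y"
        using Suc.prems by blast
      then show "\<exists>V g. open V \<and> z \<in> V \<and> continuous_on V g \<and> (\<forall>y\<in>V. f y = g y)"
        by (intro exI[of _ V] exI[of _ g]) simp
    qed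
    moreover have "(\<lambda>s. f (s, y)) field_differentiable at x \<and>
        (\<lambda>t. f (x, t)) field_differentiable at y" if xy: "(x, y) \<in> W" for x y
    proof -
      obtain V g where V: "open V" "(x, y) \<in> V" "Cm_on (Suc m) V g" "\<forall>y\<in>V. f y = g y"
        using Suc.prems[OF xy] by blast
      note ev = eventually_nhds_slices[OF eq(3)[OF V(1,4,2)]]
      show ?thesis
        using V(2,3) by (simp add: field_differentiable_cong_ev[OF ev(1)]
            field_differentiable_cong_ev[OF ev(2)]) blast
    qed
    moreover have "Cm_on m W (partial_x f)"
    proof (rule Suc.IH)
      fix z assume "z \<in> W"
      then obtain V g where V: "open V" "z \<in> V" "Cm_on (Suc m) V g" "\<forall>y\<in>V. f y = g y"
        using Suc.prems by blast
      then show "\<exists>V g. open V \<and> z \<in> V \<and> Cm_on m V g \<and> (\<forall>y\<in>V. partial_x f y = g y)"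
        using eq(1)[OF V(1,4)] by (intro exI[of _ V] exI[of _ "partial_x g"]) simp
    qed
    moreover have "Cm_on m W (partial_y f)"
    proof (rule Suc.IH)
      fix z assume "z \<in> W"
      then obtain V g where V: "open V" "z \<in> V" "Cm_on (Suc m) V g" "\<forall>y\<in>V. f y = g y"
        using Suc.prems by blast
      then show "\<exists>V g. open V \<and> z \<in> V \<and> Cm_on m V g \<and> (\<forall>y\<in>V. partial_y f y = g y)"
        using eq(2)[OF V(1,4)] by (intro exI[of _ V] exI[of _ "partial_y g"]) simp
    qed
    ultimately show ?case by (simp add: case_prod_beta)
  }
qed

lemma Cm_on_1I:
  assumes "continuous_on W f" "continuous_on W fx" "continuous_on W fy"
    and fx: "\<And>x y. (x, y) \<in> W \<Longrightarrow> ((\<lambda>s. f (s, y)) has_real_derivative fx (x, y)) (at x)"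
    and fy: "\<And>x y. (x, y) \<in> W \<Longrightarrow> ((\<lambda>t. f (x, t)) has_real_derivative fy (x, y)) (at y)"
  shows "Cm_on 1 W f"
proof -
  have "partial_x f z = fx z" "partial_y f z = fy z" if "z \<in> W" for z
    using that fx[of "fst z" "snd z"] fy[of "fst z" "snd z"]
    by (auto simp: partial_x_def partial_y_def case_prod_beta DERIV_imp_deriv)
  then have "continuous_on W (partial_x f)" "continuous_on W (partial_y f)"
    using assms(2,3) by (simp_all cong: continuous_on_cong)
  moreover have "(\<lambda>s. f (s, y)) field_differentiable at x \<and>
      (\<lambda>t. f (x, t)) field_differentiable at y" if "(x, y) \<in> W" for x y
    using fx[OF that] fy[OF that] by (auto simp: field_differentiable_def)
  ultimately show ?thesis
    using assms(1) by auto
qed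

section \<open>The operator T, the trace and the quotient\<close>

lemma continuous_on_pde_expr:
  assumes "Cm_on 1 W (\<lambda>z. real_of_ereal (u z))" "W \<subseteq> \<Omega>" "continuous_on (\<Omega> \<times> UNIV) F"
  shows "continuous_on W (pde_expr F u)"
proof -
  have "continuous_on W (\<lambda>z. F (z, (real_of_ereal (u z), partial_x (\<lambda>z. real_of_ereal (u z)) z)))"
    using assms(1) by (intro continuous_on_compose2[OF assms(3)] continuous_on_Pair)
      (use assms(2) in auto)
  then show ?thesis
    unfolding pde_expr_def Let_def using assms(1) by (intro continuous_on_add) auto
qed

text \<open>Serves twice, with \<open>D = \<Omega> - \<Gamma>\<close> for the values of T and with
  \<open>D = \<Omega>\<close> for the approximate solutions: regularisation creates normality and
  leaves \<open>w\<close> unchanged off \<Gamma>.\<close>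

lemma baire_in_ML0:
  assumes \<Omega>: "open \<Omega>" and \<Gamma>: "\<Gamma> \<subseteq> \<Omega>" "closedin (top_of_set \<Omega>) \<Gamma>" "interior (closure \<Gamma>) = {}"
    "\<Gamma> \<in> null_sets lebesgue" and w: "Cm_on m (\<Omega> - \<Gamma>) w" and D: "\<Omega> - \<Gamma> \<subseteq> D"
  defines "u \<equiv> baire_I \<Omega> \<Omega> (baire_S \<Omega> D (\<lambda>z. ereal (w z)))"
  shows "u \<in> ML0 m \<Omega>" "\<And>z. z \<in> \<Omega> - \<Gamma> \<Longrightarrow> u z = ereal (w z)"
proof -
  obtain C where "closed C" "\<Gamma> = \<Omega> \<inter> C"
    using \<Gamma> by (auto simp: closedin_closed)
  then have "\<Omega> - \<Gamma> = \<Omega> - C" by auto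
  with \<Omega> \<open>closed C\<close> have open': "open (\<Omega> - \<Gamma>)" by auto
  show eq: "u z = ereal (w z)" if "z \<in> \<Omega> - \<Gamma>" for z
    unfolding u_def using that D Cm_on_imp_continuous_on[OF w]
    by (intro baire_I_S_eq_at_continuity[OF open']) (auto intro!: continuous_intros)
  have "Cm_on m (\<Omega> - \<Gamma>) (\<lambda>z. real_of_ereal (u z))"
    using open' w eq
    by (intro Cm_on_local exI[of _ "\<Omega> - \<Gamma>"] exI[of _ w]) auto
  with \<Gamma> eq have "singular_set m \<Omega> u \<Gamma>" by (auto simp: singular_set_def)
  moreover have "u \<in> extensional \<Omega>" by (auto simp: u_def baire_I_def)
  ultimately show "u \<in> ML0 m \<Omega>"
    using normal_lsc_baire[of \<Omega> D] by (auto simp: ML0_def u_def)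
qed

text \<open>The set picked by \<open>SOME\<close> is admissible, so the differential expression is
  continuous off it and survives regularisation there. The existential hides the choice from later
  arguments.\<close>

lemma T_op_props:
  assumes u: "u \<in> ML0 1 (Omega a b)" and F: "continuous_on (closure (Omega a b) \<times> UNIV) F"
  shows "T_op a b F u \<in> ML0 0 (Omega a b)"
    and "\<exists>\<Gamma>\<subseteq>Omega a b. negligible \<Gamma> \<and> (\<forall>z\<in>Omega a b - \<Gamma>. T_op a b F u z = ereal (pde_expr F u z))"
proof -
  let ?\<Omega> = "Omega a b"
  define \<Gamma> where "\<Gamma> = (SOME \<Gamma>. singular_set 1 ?\<Omega> u \<Gamma>)"
  have \<Gamma>: "singular_set 1 ?\<Omega> u \<Gamma>"
    unfolding \<Gamma>_def using u by (auto simp: ML0_def intro: someI_ex)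
  have T: "T_op a b F u = baire_I ?\<Omega> ?\<Omega> (baire_S ?\<Omega> (?\<Omega> - \<Gamma>) (\<lambda>z. ereal (pde_expr F u z)))"
    by (simp add: T_op_def \<Gamma>_def Let_def)
  have "continuous_on (?\<Omega> - \<Gamma>) (pde_expr F u)"
    using \<Gamma> F closure_subset[of ?\<Omega>]
    by (intro continuous_on_pde_expr[of _ u "closure ?\<Omega>"]) (auto simp: singular_set_def)
  then have "Cm_on 0 (?\<Omega> - \<Gamma>) (pde_expr F u)" by simp
  note baire = baire_in_ML0[OF open_Omega _ _ _ _ this order_refl]
  show "T_op a b F u \<in> ML0 0 ?\<Omega>"
    unfolding T using \<Gamma> by (intro baire) (auto simp: singular_set_def)
  show "\<exists>\<Gamma>\<subseteq>?\<Omega>. negligible \<Gamma> \<and> (\<forall>z\<in>?\<Omega> - \<Gamma>. T_op a b F u z = ereal (pde_expr F u z))"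
    unfolding T using \<Gamma> baire(2)
    by (intro exI[of _ \<Gamma>]) (auto simp: singular_set_def negligible_iff_null_sets)
qed

text \<open>The trace condition fixes \<open>g\<close> on the open interval only; continuity carries
  it to the end points.\<close>

lemma R0_eqI:
  assumes a: "a > 0" and g: "extends_trace a u g"
  shows "R0 a u = g"
  unfolding R0_def
proof (rule the_equality)
  show "extends_trace a u g" by fact
next
  fix h assume h: "extends_trace a u h"
  have cont: "continuous_on {-a..a} f" if "f \<in> C1_interval a" for f
    using that by (auto simp: C1_interval_def intro: DERIV_continuous_on)
  have "h x - g x = 0" if "x \<in> {-a..a}" for x
  proof (rule continuous_constant_on_closure[of "{-a<..<a}" "\<lambda>x. h x - g x"])
    show "continuous_on (closure {-a<..<a}) (\<lambda>x. h x - g x)"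
      using a g h by (simp add: cont continuous_on_diff extends_trace_def)
    show "h x - g x = 0" if "x \<in> {-a<..<a}" for x
      using that g h by (auto simp: extends_trace_def)
  qed (use a that in simp)
  then have "h x = g x" if "x \<in> {-a..a}" for x using that by simp
  moreover have "h \<in> extensional {-a..a}" "g \<in> extensional {-a..a}"
    using g h by (simp_all add: extends_trace_def C1_interval_def)
  ultimately show "h = g"
    by (intro extensionalityI[of h "{-a..a}" g]) blast+
qed

lemma T0_in_Y_space:
  assumes "a > 0" "u \<in> X_space a b" "continuous_on (closure (Omega a b) \<times> UNIV) F"
  shows "T0 a b F u \<in> Y_space a b"
proof -
  obtain g where "extends_trace a u g" using assms by (auto simp: X_space_def)
  with R0_eqI[OF assms(1) this] show ?thesis
    using T_op_props(1)[OF _ assms(3)] assms(2)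
    by (auto simp: T0_def Y_space_def X_space_def extends_trace_def)
qed

definition T0_class where
  "T0_class a b F u = {(u, v). u \<in> X_space a b \<and> v \<in> X_space a b \<and> T0 a b F u = T0 a b F v} `` {u}"

lemma T0_class:
  assumes "u \<in> X_space a b"
  shows "T0_class a b F u \<in> X_T0 a b F" "T0_hat a b F (T0_class a b F u) = T0 a b F u"
proof -
  show "T0_class a b F u \<in> X_T0 a b F"
    unfolding X_T0_def T0_class_def using assms by (rule quotientI)
  have "T0 a b F ` T0_class a b F u = {T0 a b F u}"
    using assms by (auto simp: T0_class_def)
  then show "T0_hat a b F (T0_class a b F u) = T0 a b F u"
    by (simp add: T0_hat_def)
qed

section \<open>Approximate solutions\<close>

definition grid :: "real \<Rightarrow> (real \<times> real) set" where
  "grid N = {z. N * fst z \<in> \<int> \<or> N * snd z \<in> \<int>}"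

text \<open>The open grid square around \<open>z\<close>, indexed by a point instead of integers. It
  contains \<open>z\<close> exactly when \<open>z\<close> is off the grid.\<close>

definition cell :: "real \<Rightarrow> real \<times> real \<Rightarrow> (real \<times> real) set" where
  "cell N z = {p. \<lfloor>N * fst z\<rfloor> < N * fst p \<and> N * fst p < \<lfloor>N * fst z\<rfloor> + 1 \<and>
                  \<lfloor>N * snd z\<rfloor> < N * snd p \<and> N * snd p < \<lfloor>N * snd z\<rfloor> + 1}"

text \<open>In the two rows of cells next to \<open>y = 0\<close> only the initial condition is met. In every other
  cell the function is affine in \<open>y\<close>, and solves the equation with the arguments of \<open>F\<close> frozen at
  the lower left corner of the cell and at \<open>u = D\<^sub>x u = 0\<close>.\<close>

definition approx_sol ::
  "((real \<times> real) \<times> (real \<times> real) \<Rightarrow> real) \<Rightarrow> (real \<Rightarrow> real) \<Rightarrow> real \<Rightarrow> real \<times> real \<Rightarrow> real" where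
  "approx_sol F f N z =
     (if \<lfloor>N * snd z\<rfloor> \<in> {-1, 0} then f (fst z)
      else - F ((\<lfloor>N * fst z\<rfloor> / N, \<lfloor>N * snd z\<rfloor> / N), (0, 0)) * (snd z - \<lfloor>N * snd z\<rfloor> / N))"

lemma closed_grid: "closed (grid N)"
proof -
  have "grid N = (\<lambda>z. N * fst z) -` \<int> \<union> (\<lambda>z. N * snd z) -` \<int>"
    by (auto simp: grid_def)
  then show ?thesis
    by (simp add: closed_Un closed_vimage continuous_on_fst continuous_on_snd continuous_on_mult)
qed

lemma negligible_grid:
  assumes "N > 0"
  shows "negligible (grid N)"
proof -
  have "grid N = (\<Union>k::int. {z. (1, 0) \<bullet> z = k / N}) \<union> (\<Union>k::int. {z. (0, 1) \<bullet> z = k / N})"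
    using assms by (auto simp: grid_def Ints_def field_simps inner_prod_def)
  moreover have "negligible (\<Union>k::int. {z::real \<times> real. (1, 0) \<bullet> z = k / N})"
    "negligible (\<Union>k::int. {z::real \<times> real. (0, 1) \<bullet> z = k / N})"
    by (intro negligible_countable_Union; auto intro!: negligible_hyperplane simp: zero_prod_def)+
  ultimately show ?thesis by (metis negligible_Un)
qed

lemma open_cell: "open (cell N z)"
  unfolding cell_def by (intro open_Collect_conj open_Collect_less continuous_intros)

lemma mem_cell: "z \<notin> grid N \<Longrightarrow> z \<in> cell N z"
proof -
  have "of_int \<lfloor>t\<rfloor> < t" if "t \<notin> \<int>" for t :: real
    using that by (metis Ints_of_int less_eq_real_def of_int_floor_le)
  then show "z \<notin> grid N \<Longrightarrow> z \<in> cell N z"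
    by (auto simp: grid_def cell_def)
qed

lemma floor_cell:
  assumes "p \<in> cell N z"
  shows "\<lfloor>N * fst p\<rfloor> = \<lfloor>N * fst z\<rfloor>" "\<lfloor>N * snd p\<rfloor> = \<lfloor>N * snd z\<rfloor>"
  using assms by (auto simp: cell_def intro!: floor_unique)

lemma approx_sol_cell:
  assumes "p \<in> cell N z"
  shows "approx_sol F f N p =
     (if \<lfloor>N * snd z\<rfloor> \<in> {-1, 0} then f (fst p)
      else - F ((\<lfloor>N * fst z\<rfloor> / N, \<lfloor>N * snd z\<rfloor> / N), (0, 0)) * (snd p - \<lfloor>N * snd z\<rfloor> / N))"
  by (simp add: approx_sol_def floor_cell[OF assms])

lemma C1_interval_interior:
  assumes "f \<in> C1_interval a"
  obtains f' where "\<And>x. x \<in> {-a<..<a} \<Longrightarrow> (f has_real_derivative f' x) (at x)"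
    "continuous_on {-a<..<a} f'" "continuous_on {-a<..<a} f"
proof -
  obtain f' where f': "\<And>x. x \<in> {-a..a} \<Longrightarrow> (f has_real_derivative f' x) (at x within {-a..a})"
    "continuous_on {-a..a} f'"
    using assms unfolding C1_interval_def by blast
  have sub: "{-a<..<a} \<subseteq> {-a..a}" by auto
  have d: "(f has_real_derivative f' x) (at x)" if "x \<in> {-a<..<a}" for x
  proof -
    have "at x within {-a..a} = at x"
      using that interior_atLeastAtMost_real[of "-a" a] by (intro at_within_interior) auto
    with f'(1)[of x] that show ?thesis by auto
  qed
  moreover have "continuous_on {-a<..<a} f'" using f'(2) sub continuous_on_subset by blast
  moreover have "continuous_on {-a<..<a} f"
    by (intro continuous_at_imp_continuous_on ballI DERIV_isCont[OF d])
  ultimately show thesis using that by blast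
qed

text \<open>The floors are constant on a cell, so each cell carries a single formula, and the cells
  cover the complement of the grid.\<close>

lemma Cm_on_approx_sol:
  assumes f: "f \<in> C1_interval a"
  shows "Cm_on 1 (Omega a b - grid N) (approx_sol F f N)"
proof (rule Cm_on_local)
  fix z assume z: "z \<in> Omega a b - grid N"
  obtain f' where f': "\<And>x. x \<in> {-a<..<a} \<Longrightarrow> (f has_real_derivative f' x) (at x)"
    "continuous_on {-a<..<a} f'" "continuous_on {-a<..<a} f"
    using C1_interval_interior[OF f] by blast
  let ?V = "cell N z \<inter> Omega a b"
  have V: "\<And>p. p \<in> ?V \<Longrightarrow> fst p \<in> {-a<..<a}" by (auto simp: Omega_def)
  have 1: "Cm_on 1 ?V (\<lambda>p. f (fst p))"
    using V by (intro Cm_on_1I[where fx = "\<lambda>p. f' (fst p)" and fy = "\<lambda>_. 0"]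
        continuous_on_compose2[OF f'(2)] continuous_on_compose2[OF f'(3)] continuous_intros)
      (auto intro!: f' dest: V)
  have 2: "Cm_on 1 ?V (\<lambda>p. q * (snd p - c))" for q c
    by (intro Cm_on_1I[where fx = "\<lambda>_. 0" and fy = "\<lambda>_. q"] continuous_intros)
      (auto intro!: derivative_eq_intros)
  define g where "g = (if \<lfloor>N * snd z\<rfloor> \<in> {-1, 0} then (\<lambda>p. f (fst p))
      else (\<lambda>p. - F ((\<lfloor>N * fst z\<rfloor> / N, \<lfloor>N * snd z\<rfloor> / N), (0, 0)) * (snd p - \<lfloor>N * snd z\<rfloor> / N)))"
  have "Cm_on 1 ?V g" using 1 2 by (simp only: g_def split: if_split) blast
  moreover have "\<forall>p\<in>?V. approx_sol F f N p = g p"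
    by (auto simp: approx_sol_cell g_def)
  moreover have "open ?V" "z \<in> ?V" using z mem_cell by (blast intro: open_Int open_cell open_Omega)+
  ultimately show "\<exists>V g. open V \<and> z \<in> V \<and> Cm_on 1 V g \<and> (\<forall>p\<in>V. approx_sol F f N p = g p)"
    by blast
qed

text \<open>The inner domain is all of \<Omega>, grid included: the trace is read on y = 0, itself a
  grid line, and the continuity argument there wants a neighbourhood inside that domain.\<close>

definition approx_ML ::
  "real \<Rightarrow> real \<Rightarrow> ((real \<times> real) \<times> (real \<times> real) \<Rightarrow> real) \<Rightarrow> (real \<Rightarrow> real) \<Rightarrow> real \<Rightarrow>
     real \<times> real \<Rightarrow> ereal" where
  "approx_ML a b F f N =
     baire_I (Omega a b) (Omega a b) (baire_S (Omega a b) (Omega a b) (\<lambda>z. ereal (approx_sol F f N z)))"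

lemma approx_ML:
  assumes f: "f \<in> C1_interval a" and N: "N > 0"
  shows "approx_ML a b F f N \<in> ML0 1 (Omega a b)"
    and "\<And>z. z \<in> Omega a b - grid N \<Longrightarrow> approx_ML a b F f N z = ereal (approx_sol F f N z)"
proof -
  let ?\<Omega> = "Omega a b" and ?\<Gamma> = "Omega a b \<inter> grid N"
  have "negligible (closure ?\<Gamma>)"
    using negligible_grid[OF N] closed_grid[of N]
    by (meson closure_minimal inf_le2 negligible_subset)
  then have int: "interior (closure ?\<Gamma>) = {}"
    by (rule negligible_imp_interior_empty)
  have cl: "closedin (top_of_set ?\<Omega>) ?\<Gamma>"
    by (simp add: closedin_closed_Int closed_grid)
  have null: "?\<Gamma> \<in> null_sets lebesgue"
    using negligible_grid[OF N] by (auto simp flip: negligible_iff_null_sets intro: negligible_Int)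
  have eq: "?\<Omega> - ?\<Gamma> = ?\<Omega> - grid N" by auto
  note baire = baire_in_ML0[OF open_Omega _ cl int null, of 1 "approx_sol F f N" ?\<Omega>,
      folded approx_ML_def, unfolded eq, OF _ Cm_on_approx_sol[OF f]]
  show "approx_ML a b F f N \<in> ML0 1 (Omega a b)"
    "\<And>z. z \<in> Omega a b - grid N \<Longrightarrow> approx_ML a b F f N z = ereal (approx_sol F f N z)"
    using baire by auto
qed

text \<open>As the rows on both sides of y = 0 carry f(x), the unregularised function is continuous
  across that grid line and across the vertical ones near it, so regularisation keeps its
  value.\<close>

lemma extends_trace_approx_ML:
  assumes f: "f \<in> C1_interval a" and b: "b > 0" and N: "N > 0"
  shows "extends_trace a (approx_ML a b F f N) f"
proof -
  let ?W = "{-a<..<a} \<times> ({-b<..<b} \<inter> {- inverse N<..<inverse N})"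
  have eq: "approx_sol F f N p = f (fst p)" if "p \<in> ?W" for p
  proof -
    have "-1 < N * snd p" "N * snd p < 1"
      using that N by (auto simp: field_simps)
    then have "\<lfloor>N * snd p\<rfloor> \<in> {-1, 0}" by simp linarith
    then show ?thesis by (simp add: approx_sol_def)
  qed
  obtain f' where "continuous_on {-a<..<a} f"
    using C1_interval_interior[OF f] by blast
  then have "continuous_on ?W (\<lambda>p. ereal (f (fst p)))"
    by (intro continuous_on_ereal continuous_on_compose2[of _ f _ fst] continuous_intros) auto
  then have "continuous_on ?W (\<lambda>p. ereal (approx_sol F f N p))"
    by (simp add: eq cong: continuous_on_cong)
  then have "approx_ML a b F f N (x, 0) = ereal (f x)" if "x \<in> {-a<..<a}" for x
    unfolding approx_ML_def using that b N
    by (subst baire_I_S_eq_at_continuity[of ?W]) (auto simp: Omega_def open_Times eq)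
  with f show ?thesis by (simp add: extends_trace_def)
qed

lemma approx_ML_in_X_space:
  assumes "f \<in> C1_interval a" "b > 0" "N > 0"
  shows "approx_ML a b F f N \<in> X_space a b"
  using approx_ML(1)[OF assms(1,3)] extends_trace_approx_ML[OF assms]
  by (auto simp: X_space_def)

lemma pde_expr_approx_ML:
  fixes F :: "(real \<times> real) \<times> (real \<times> real) \<Rightarrow> real"
  assumes f: "f \<in> C1_interval a" and N: "N > 0" and z: "z \<in> Omega a b - grid N"
    and far: "N * \<bar>snd z\<bar> > 1"
  defines "c \<equiv> \<lfloor>N * snd z\<rfloor> / N" and "q \<equiv> - F ((\<lfloor>N * fst z\<rfloor> / N, \<lfloor>N * snd z\<rfloor> / N), (0, 0))"
  shows "pde_expr F (approx_ML a b F f N) z = q + F (z, (q * (snd z - c), 0))"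
proof -
  let ?v = "\<lambda>w. real_of_ereal (approx_ML a b F f N w)" and ?g = "\<lambda>p. q * (snd p - c)"
  let ?V = "cell N z \<inter> (Omega a b - grid N)"
  have row: "\<lfloor>N * snd z\<rfloor> \<notin> {-1, 0}"
  proof
    assume "\<lfloor>N * snd z\<rfloor> \<in> {-1, 0}"
    then have "-1 \<le> N * snd z" "N * snd z < 1" by auto linarith+
    then have "\<bar>N * snd z\<bar> \<le> 1" by linarith
    with far N show False by (simp add: abs_mult)
  qed
  have eq: "?v p = ?g p" if "p \<in> ?V" for p
  proof -
    have "?v p = approx_sol F f N p" using that by (simp add: approx_ML(2)[OF f N])
    also have "\<dots> = ?g p"
      using that by (subst approx_sol_cell[of p N z]) (auto simp only: if_not_P[OF row] c_def q_def)
    finally show ?thesis .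
  qed
  have "open ?V" using open_cell open_Omega closed_grid by (intro open_Int open_Diff)
  moreover have "z \<in> ?V" using z mem_cell by auto
  ultimately have ev: "eventually (\<lambda>p. ?v p = ?g p) (nhds z)"
    unfolding eventually_nhds using eq by blast
  have "partial_x ?v z = 0"
    unfolding partial_cong_ev(1)[OF ev] by (simp add: partial_x_def case_prod_beta)
  moreover have "partial_y ?v z = q"
    unfolding partial_cong_ev(2)[OF ev]
    by (auto simp: partial_y_def case_prod_beta intro!: DERIV_imp_deriv derivative_eq_intros)
  moreover have "?v z = ?g z" using eq \<open>z \<in> ?V\<close> by blast
  ultimately show ?thesis by (simp add: pde_expr_def)
qed

lemma floor_div_tendsto:
  fixes x :: real
  shows "(\<lambda>n. \<lfloor>real (Suc n) * x\<rfloor> / real (Suc n)) \<longlonglongrightarrow> x"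
proof (rule real_tendsto_sandwich)
  show "\<forall>\<^sub>F n in sequentially. x - inverse (real (Suc n)) \<le> \<lfloor>real (Suc n) * x\<rfloor> / real (Suc n)"
  proof (rule always_eventually, rule allI)
    fix n
    have "real (Suc n) * x - 1 \<le> \<lfloor>real (Suc n) * x\<rfloor>" by linarith
    then have "(real (Suc n) * x - 1) / real (Suc n) \<le> \<lfloor>real (Suc n) * x\<rfloor> / real (Suc n)"
      by (rule divide_right_mono) simp
    then show "x - inverse (real (Suc n)) \<le> \<lfloor>real (Suc n) * x\<rfloor> / real (Suc n)"
      by (simp add: diff_divide_distrib inverse_eq_divide)
  qed
  show "\<forall>\<^sub>F n in sequentially. \<lfloor>real (Suc n) * x\<rfloor> / real (Suc n) \<le> x"
  proof (rule always_eventually, rule allI)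
    fix n
    have "\<lfloor>real (Suc n) * x\<rfloor> \<le> real (Suc n) * x" by linarith
    then show "\<lfloor>real (Suc n) * x\<rfloor> / real (Suc n) \<le> x"
      by (simp add: field_simps)
  qed
  show "(\<lambda>n. x - inverse (real (Suc n))) \<longlonglongrightarrow> x"
    using tendsto_diff[OF tendsto_const LIMSEQ_inverse_real_of_nat, of x] by simp
qed auto

lemma pde_expr_approx_ML_tendsto:
  assumes f: "f \<in> C1_interval a" and F: "continuous_on (closure (Omega a b) \<times> UNIV) F"
    and z: "z \<in> Omega a b" "\<And>n. z \<notin> grid (real (Suc n))" "snd z \<noteq> 0"
  shows "(\<lambda>n. pde_expr F (approx_ML a b F f (real (Suc n))) z) \<longlonglongrightarrow> 0"
proof -
  define c where "c n = \<lfloor>real (Suc n) * snd z\<rfloor> / real (Suc n)" for n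
  define d where "d n = \<lfloor>real (Suc n) * fst z\<rfloor> / real (Suc n)" for n
  define q where "q n = - F ((d n, c n), (0, 0))" for n
  have cd: "c \<longlonglongrightarrow> snd z" "d \<longlonglongrightarrow> fst z"
    unfolding c_def d_def by (rule floor_div_tendsto)+
  have "continuous_on (Omega a b \<times> UNIV) F"
    using F closure_subset by (blast intro: continuous_on_subset)
  then have cont: "isCont F (z, (0, 0))"
    using z(1) by (simp add: continuous_on_eq_continuous_at open_Times open_Omega)
  have "(\<lambda>n. ((d n, c n), (0::real, 0::real))) \<longlonglongrightarrow> ((fst z, snd z), (0, 0))"
    by (intro tendsto_intros cd)
  then have q: "q \<longlonglongrightarrow> - F (z, (0, 0))"
    unfolding q_def by (intro tendsto_minus isCont_tendsto_compose[OF cont]) simp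
  \<comment> \<open>The height above the lower edge of the cell tends to 0 while the slope
    converges, so the u-argument returns to its frozen value 0.\<close>
  have "(\<lambda>n. q n * (snd z - c n)) \<longlonglongrightarrow> - F (z, (0, 0)) * (snd z - snd z)"
    by (intro tendsto_intros q cd)
  then have "(\<lambda>n. (z, (q n * (snd z - c n), 0::real))) \<longlonglongrightarrow> (z, (0, 0))"
    by (intro tendsto_intros) simp
  then have "(\<lambda>n. q n + F (z, (q n * (snd z - c n), 0))) \<longlonglongrightarrow> - F (z, (0, 0)) + F (z, (0, 0))"
    by (intro tendsto_add q isCont_tendsto_compose[OF cont])
  moreover have "\<forall>\<^sub>F n in sequentially.
      q n + F (z, (q n * (snd z - c n), 0)) = pde_expr F (approx_ML a b F f (real (Suc n))) z"
  proof -
    \<comment> \<open>From \<open>M\<close> on the strip around y = 0 no longer contains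
      \<open>z\<close>; \<open>M\<close> depends on \<open>z\<close>, so convergence is only
      pointwise.\<close>
    obtain M where M: "inverse (real (Suc M)) < \<bar>snd z\<bar>"
      using z(3) reals_Archimedean[of "\<bar>snd z\<bar>"] by auto
    have "1 < real (Suc n) * \<bar>snd z\<bar>" if "n \<ge> M" for n
    proof -
      have "1 < real (Suc M) * \<bar>snd z\<bar>" using M by (simp add: field_simps)
      also have "\<dots> \<le> real (Suc n) * \<bar>snd z\<bar>" using that by (intro mult_right_mono) auto
      finally show ?thesis .
    qed
    then show ?thesis
      unfolding eventually_sequentially q_def c_def d_def
      using pde_expr_approx_ML[OF f, symmetric] z(1,2)
      by (intro exI[of _ M] allI impI) auto
  qed
  ultimately show ?thesis
    using Lim_transform_eventually by fastforce
qed

lemma zero_in_ML0: "(\<lambda>z\<in>Omega a b. 0) \<in> ML0 0 (Omega a b)"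
proof -
  let ?\<Omega> = "Omega a b" and ?u = "\<lambda>z\<in>Omega a b. 0 :: ereal"
  have "continuous_on ?\<Omega> ?u" by (simp cong: continuous_on_cong)
  then have "normal_lsc ?\<Omega> ?u"
    unfolding normal_lsc_def using baire_I_S_eq_at_continuity[OF open_Omega] by blast
  moreover have "singular_set 0 ?\<Omega> ?u {}"
    by (auto simp: singular_set_def cong: continuous_on_cong)
  ultimately show ?thesis by (auto simp: ML0_def)
qed

lemma filtermap_sequentially_in_filters_on:
  "(\<And>n. g n \<in> Z) \<Longrightarrow> filtermap g sequentially \<in> filters_on Z"
  by (auto simp: filters_on_def filtermap_bot_iff le_principal eventually_filtermap)

lemma T0_approx_ML_conv_Y:
  assumes a: "a > 0" and b: "b > 0" and F: "continuous_on (closure (Omega a b) \<times> UNIV) F"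
    and f: "f \<in> C1_interval a"
  shows "filtermap (\<lambda>n. T0 a b F (approx_ML a b F f (real (Suc n)))) sequentially
    \<in> conv_Y a b ((\<lambda>z\<in>Omega a b. 0), f)"
proof -
  let ?u = "\<lambda>n. approx_ML a b F f (real (Suc n))"
  have u: "?u n \<in> X_space a b" "extends_trace a (?u n) f" for n
    using approx_ML_in_X_space[OF f b] extends_trace_approx_ML[OF f b] by auto
  then have u_ML0: "?u n \<in> ML0 1 (Omega a b)" for n by (simp add: X_space_def)
  obtain \<Gamma> where \<Gamma>: "\<And>n. \<Gamma> n \<subseteq> Omega a b" "\<And>n. negligible (\<Gamma> n)"
    "\<And>n z. z \<in> Omega a b - \<Gamma> n \<Longrightarrow> T_op a b F (?u n) z = ereal (pde_expr F (?u n) z)"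
    using T_op_props(2)[OF u_ML0 F] by metis
  \<comment> \<open>Countably many null sets: the exceptional sets of all T u_n, all grids, and the
    line y = 0, whose points never leave the strip.\<close>
  define E where "E = Omega a b \<inter> ((\<Union>n. \<Gamma> n) \<union> (\<Union>n. grid (real (Suc n))) \<union> {z. (0, 1) \<bullet> z = 0})"
  have "negligible E"
    unfolding E_def using \<Gamma>(2)
    by (intro negligible_Int disjI2 negligible_Un negligible_countable_Union)
      (auto intro!: negligible_hyperplane negligible_grid simp: zero_prod_def)
  moreover have "((\<lambda>n. T_op a b F (?u n) z) \<longlongrightarrow> (\<lambda>z\<in>Omega a b. 0) z) sequentially"
    if "z \<in> Omega a b - E" for z
  proof -
    have z: "z \<in> Omega a b" "\<And>n. z \<notin> \<Gamma> n" "\<And>n. z \<notin> grid (real (Suc n))" "snd z \<noteq> 0"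
      using that by (auto simp: E_def inner_prod_def)
    have "(\<lambda>n. ereal (pde_expr F (?u n) z)) \<longlonglongrightarrow> ereal 0"
      using pde_expr_approx_ML_tendsto[OF f F z(1,3,4)] by (rule tendsto_ereal)
    with z show ?thesis by (simp add: \<Gamma>(3) zero_ereal_def del: of_nat_Suc)
  qed
  moreover have "E \<subseteq> Omega a b" by (auto simp: E_def)
  ultimately have "filtermap (\<lambda>n. T_op a b F (?u n)) sequentially
      \<in> conv_a (Omega a b) (\<lambda>z\<in>Omega a b. 0)"
    unfolding conv_a_def using T_op_props(1)[OF u_ML0 F]
    by (auto intro!: filtermap_sequentially_in_filters_on exI[of _ E] simp: filterlim_filtermap negligible_iff_null_sets)
  \<comment> \<open>Every trace is exactly f, so this is the image under a constant map.\<close>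
  moreover have "filtermap (\<lambda>n. R0 a (?u n)) sequentially \<in> conv_0 a f"
    using f filtermap_sequentially_in_filters_on[of "\<lambda>_. f" "C1_interval a"]
    by (simp add: R0_eqI[OF a u(2)] conv_0_def le_principal eventually_filtermap del: of_nat_Suc)
  ultimately show ?thesis
    using T0_in_Y_space[OF a u(1) F]
    by (auto simp: conv_Y_def filtermap_filtermap T0_def intro!: filtermap_sequentially_in_filters_on)
qed

theorem theorem1:
  fixes a b :: real
    and F :: "(real \<times> real) \<times> (real \<times> real) \<Rightarrow> real"
  assumes "a > 0" and "b > 0"
    and "continuous_on (closure (Omega a b) \<times> UNIV) F"
  shows "\<forall>f\<in>C1_interval a. \<exists>!U. U \<in> X_T0_sharp a b F \<and>
           T0_hat_sharp a b F U = ((\<lambda>z\<in>Omega a b. 0), f)"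
proof
  fix f assume f: "f \<in> C1_interval a"
  interpret Y: complete_hausdorff_ucs "Y_space a b" "ucs_Y a b" "conv_Y a b"
    by (rule complete_hausdorff_ucs_Y)
  \<comment> \<open>Passing to classes changes no value of the operator; \<open>Suc n\<close> keeps
    the grid parameter positive.\<close>
  let ?C = "\<lambda>n. T0_class a b F (approx_ML a b F f (real (Suc n)))"
  have X: "approx_ML a b F f (real (Suc n)) \<in> X_space a b" for n
    using f assms(2) by (intro approx_ML_in_X_space) auto
  have "filtermap ?C sequentially \<in> filters_on (X_T0 a b F)"
    by (intro filtermap_sequentially_in_filters_on T0_class(1) X)
  moreover have "filtermap (T0_hat a b F) (filtermap ?C sequentially)
      \<in> conv_Y a b ((\<lambda>z\<in>Omega a b. 0), f)"
    using T0_approx_ML_conv_Y[OF assms f] by (simp add: filtermap_filtermap T0_class(2)[OF X] del: of_nat_Suc)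
  moreover have "((\<lambda>z\<in>Omega a b. 0), f) \<in> Y_space a b"
    using zero_in_ML0 f by (simp add: Y_space_def)
  \<comment> \<open>\<open>ucs_T0_def\<close> has exactly the form \<open>K_eq\<close> of an initial
    structure, with \<open>T0_hat\<close> as the map \<open>g\<close>.\<close>
  ultimately obtain U where "U \<in> X_T0_sharp a b F"
    "T0_hat_sharp a b F U = ((\<lambda>z\<in>Omega a b. 0), f)"
    unfolding X_T0_sharp_def T0_hat_sharp_def
    using Y.completion_extension_initial_attains[OF ucs_T0_def] by blast
  moreover have "inj_on (T0_hat_sharp a b F) (X_T0_sharp a b F)"
    unfolding X_T0_sharp_def T0_hat_sharp_def
    by (rule Y.inj_on_completion_extension_initial[OF ucs_T0_def])
  ultimately show "\<exists>!U. U \<in> X_T0_sharp a b F \<and>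
      T0_hat_sharp a b F U = ((\<lambda>z\<in>Omega a b. 0), f)"
    by (metis inj_onD)
qed

end
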